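(* For every clan $\alpha\in\mathtt{Clans}_{p,q}$, there is an isomorphism of varieties $X_\alpha\cong S_\alpha$ between the Mars-Springer slice $X_\alpha$ to $Q_\alpha$ at $x_\alpha K/K$ in $GL_n/(GL_p\times GL_q)$ (where $n=p+q$) and the affine space of matrices $S_\alpha$.
   Context: All varieties are over $\mathbb{C}$; $n=p+q$. **Clans.** A $(p,q)$-clan is a partial matching of the vertices $\{1,\dots,n\}$ in which each unmatched vertex is assigned a sign $+$ or $-$, such that the number of $+$'s minus the number of $-$'s is $p-q$. It is written as a string $\alpha=\alpha_1\dots\alpha_n$ with entries in $\mathbb{N}\cup\{+,-\}$, a pair of equal numbers indicating a matching; strings differing by a permutation of the natural numbers represent the same clan. A matched pair $i<j$ is called a matching $(i<j)$, with left end $i$ and right end $j$. $\mathtt{Clans}_{p,q}$ is the set of $(p,q)$-clans. **The permutation $w_\alpha\in S_n$.** The values $1,\dots,p$ are assigned from left to right to the positions of the $+$'s and left ends of matchings of $\alpha$; the values $p+1,\dots,n$ are assigned while reading $\alpha$ from left to right: upon meeting a $-$, assign the smallest unused value of $\{p+1,\dots,n\}$ to its position, and upon meeting a left end of a matching, immediately assign the smallest unused value of $\{p+1,\dots,n\}$ to the corresponding right end. **The affine space $S_\alpha$.** The generic matrix $M_\alpha(\mathbf{z})$ ($n\times n$) has fixed entries: (O.1) if $\alpha_i=\pm$, row $i$ has a $1$ in position $w_\alpha(i)$; (O.2) if $(i<j)$ is a matching, row $i$ has $1$'s in positions $w_\alpha(i)$ and $w_\alpha(j)$; (O.3) if $(j<i)$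 is a matching, row $i$ has $-1$ in position $w_\alpha(j)$ and $1$ in position $w_\alpha(i)$. A pivot is the northmost of these $1$'s in each column. In the first $p$ columns, set to $0$ all (other) entries: (Z.1) in the same row as a pivot; (Z.2) above a pivot in its column; (Z.3) between the pivot $1$ and the corresponding $-1$ of a column; (Z.4) right of a $-1$. In the last $q$ columns, set to $0$ all (other) entries: (Z.5) in the same row as a pivot; (Z.6) above a pivot in its column; (Z.7) between the pivot $1$ and the second $1$ below it in its column; (Z.8) right of a $1$ which is the second $1$ in its column. The remaining entries $z_{ij}$ are independent variables except: (Z.9) for each pair of matchings $(i<k)$, $(j<\ell)$ with $i<j<k<\ell$, the entry at $(\ell,w_\alpha(k))$ is $-z_{\ell,w_\alpha(i)}$, where $z_{\ell,w_\alpha(i)}$ is the entry at $(\ell,w_\alpha(i))$. $S_\alpha$ is the affine space of all matrices obtained by specializing the variables of $M_\alpha(\mathbf{z})$ to complex numbers. **The slice $X_\alpha$.** $G=GL_n(\mathbb{C})$; $K=GL_p\times GL_q$ is the block diagonal subgroup, the fixed subgroup of the involution $\theta(M)=I_{p,q}MI_{p,q}$, where $I_{p,q}$ is diagonal with $p$ entries $1$ followed by $q$ entries $-1$; $B$ is the upper triangular Borel subgroup, $T$ the diagonal torus, $N$ its normalizer, $U^-$ the group of lower triangular unipotent matrices. Let $x=x_\alpha$ be the matrix in $S_\alpha$ with all $\mathbf{z}$-variables set to $0$. One has $x\theta(x)^{-1}\in N$; let $\eta$ be its class in $N/T=S_n$ and $\psi=c_\eta\circ\theta$, where $c_\eta$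 is conjugation by (a representative of) $\eta$; the group $U^-\cap\psi(U^-)$ does not depend on the representative. $Q_\alpha=Bx_\alpha K/K$ is the $B$-orbit on $G/K$ corresponding to $\alpha$, and $$X_\alpha=(U^-\cap\psi(U^-))\cdot x_\alpha K/K\subseteq G/K.$$ *)

theory Defs
  imports
    "HOL-Analysis.Abstract_Topology"
    "HOL-Algebra.Left_Coset"
    "Jordan_Normal_Form.Matrix"
begin

section \<open>Varieties as spaces with functions\<close>

text \<open>
  A (reduced) complex variety is treated as a space with functions: a topological space with, for
  each open set \<open>U\<close>, the complex-valued functions regular on \<open>U\<close>. Functions are total in HOL;
  \<open>regular X U f\<close> is only meaningful for \<open>U\<close> open in \<open>X\<close> and depends only on the values of \<open>f\<close>
  on \<open>U\<close>.
\<close>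

record 'a fun_space =
  ztop :: "'a topology"
  regular :: "'a set \<Rightarrow> ('a \<Rightarrow> complex) \<Rightarrow> bool"

definition fs_morphism :: "'a fun_space \<Rightarrow> 'b fun_space \<Rightarrow> ('a \<Rightarrow> 'b) \<Rightarrow> bool" where
  "fs_morphism X Y \<phi> \<longleftrightarrow>
     continuous_map (ztop X) (ztop Y) \<phi> \<and>
     (\<forall>V f. openin (ztop Y) V \<longrightarrow> regular Y V f \<longrightarrow>
        regular X {x \<in> topspace (ztop X). \<phi> x \<in> V} (f \<circ> \<phi>))"

definition fs_isomorphic :: "'a fun_space \<Rightarrow> 'b fun_space \<Rightarrow> bool" where
  "fs_isomorphic X Y \<longleftrightarrow>
     (\<exists>\<phi> \<chi>. fs_morphism X Y \<phi> \<and> fs_morphism Y X \<chi> \<and>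
        (\<forall>x \<in> topspace (ztop X). \<chi> (\<phi> x) = x) \<and>
        (\<forall>y \<in> topspace (ztop Y). \<phi> (\<chi> y) = y))"

text \<open>
  The induced structure on a subset: the regular functions are locally restrictions of regular
  functions of the ambient space. For locally closed subsets of a variety this is the reduced
  subvariety.
\<close>

definition fs_subspace :: "'a fun_space \<Rightarrow> 'a set \<Rightarrow> 'a fun_space" where
  "fs_subspace X S =
     \<lparr>ztop = subtopology (ztop X) S,
      regular = (\<lambda>V f. \<forall>x\<in>V. \<exists>W g. openin (ztop X) W \<and> x \<in> W \<and> regular X W g \<and>
                                   (\<forall>y \<in> W \<inter> V. f y = g y))\<rparr>"

text \<open>
  The quotient structure along \<open>\<pi>\<close>: a function on an open set is regular iff its pullback is. For
  the projection of a linear algebraic group onto its cosets by a closed subgroup this is the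
  homogeneous space.
\<close>

definition fs_quotient :: "'a fun_space \<Rightarrow> ('a \<Rightarrow> 'b) \<Rightarrow> 'b fun_space" where
  "fs_quotient X \<pi> =
     \<lparr>ztop = topology (\<lambda>U. U \<subseteq> \<pi> ` topspace (ztop X) \<and>
                          openin (ztop X) {x \<in> topspace (ztop X). \<pi> x \<in> U}),
      regular = (\<lambda>U f. regular X {x \<in> topspace (ztop X). \<pi> x \<in> U} (f \<circ> \<pi>))\<rparr>"

lemma openin_fs_quotient:
  "openin (ztop (fs_quotient X \<pi>)) U \<longleftrightarrow>
     U \<subseteq> \<pi> ` topspace (ztop X) \<and> openin (ztop X) {x \<in> topspace (ztop X). \<pi> x \<in> U}"
proof -
  define T where "T = ztop X"
  define P where "P U = {x \<in> topspace T. \<pi> x \<in> U}" for U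
  have Int: "P (S \<inter> S') = P S \<inter> P S'" for S S'
    by (auto simp: P_def)
  have Un: "P (\<Union>\<K>) = \<Union>(P ` \<K>)" for \<K>
    by (auto simp: P_def)
  have "istopology (\<lambda>U. U \<subseteq> \<pi> ` topspace T \<and> openin T (P U))"
    unfolding istopology_def Int Un by (auto intro: openin_Int openin_Union)
  then show ?thesis
    by (simp add: fs_quotient_def T_def P_def)
qed

inductive poly_fun :: "nat \<Rightarrow> (complex mat \<Rightarrow> complex) \<Rightarrow> bool" for n where
  const: "poly_fun n (\<lambda>_. a)"
| entry: "i < n \<Longrightarrow> j < n \<Longrightarrow> poly_fun n (\<lambda>A. A $$ (i, j))"
| add: "poly_fun n f \<Longrightarrow> poly_fun n g \<Longrightarrow> poly_fun n (\<lambda>A. f A + g A)"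
| mult: "poly_fun n f \<Longrightarrow> poly_fun n g \<Longrightarrow> poly_fun n (\<lambda>A. f A * g A)"

text \<open>
  The affine space of \<open>n \<times> n\<close> matrices with its Zariski topology (generated by the principal open
  sets); regular functions are locally quotients of polynomials.
\<close>

definition matrix_space :: "nat \<Rightarrow> complex mat fun_space" where
  "matrix_space n =
     (let Z = topology_generated_by {{A \<in> carrier_mat n n. f A \<noteq> 0} | f. poly_fun n f} in
      \<lparr>ztop = Z,
       regular = (\<lambda>U f. \<forall>A\<in>U. \<exists>W a b. openin Z W \<and> A \<in> W \<and> W \<subseteq> U \<and>
                    poly_fun n a \<and> poly_fun n b \<and> (\<forall>C\<in>W. b C \<noteq> 0 \<and> f C = a C / b C))\<rparr>)"

section \<open>The groups and the homogeneous space\<close>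

definition GL :: "nat \<Rightarrow> complex mat monoid" where
  "GL n = units_of (ring_mat TYPE(complex) n ())"

definition K_grp :: "nat \<Rightarrow> nat \<Rightarrow> complex mat set" where
  "K_grp p q = {four_block_mat A (0\<^sub>m p q) (0\<^sub>m q p) D | A D.
                  A \<in> carrier (GL p) \<and> D \<in> carrier (GL q)}"

definition I_pq :: "nat \<Rightarrow> nat \<Rightarrow> complex mat" where
  "I_pq p q = four_block_mat (1\<^sub>m p) (0\<^sub>m p q) (0\<^sub>m q p) (- 1\<^sub>m q)"

definition theta :: "nat \<Rightarrow> nat \<Rightarrow> complex mat \<Rightarrow> complex mat" where
  "theta p q M = I_pq p q * M * I_pq p q"

definition U_minus :: "nat \<Rightarrow> complex mat set" where
  "U_minus n = {A \<in> carrier_mat n n. (\<forall>i<n. A $$ (i, i) = 1) \<and>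
                                     (\<forall>i<n. \<forall>j<n. i < j \<longrightarrow> A $$ (i, j) = 0)}"

text \<open>The homogeneous space \<open>GL_n / K\<close>; its points are the left cosets \<open>g K\<close>.\<close>

definition GL_mod_K :: "nat \<Rightarrow> nat \<Rightarrow> complex mat set fun_space" where
  "GL_mod_K p q = (let n = p + q in
     fs_quotient (fs_subspace (matrix_space n) (carrier (GL n)))
                 (\<lambda>g. g <#\<^bsub>GL n\<^esub> K_grp p q))"

lemma topspace_GL_mod_K: "topspace (ztop (GL_mod_K p q)) = lcosets\<^bsub>GL (p + q)\<^esub> (K_grp p q)"
proof -
  let ?n = "p + q"
  let ?Y = "fs_subspace (matrix_space ?n) (carrier (GL ?n))"
  let ?\<pi> = "\<lambda>g. g <#\<^bsub>GL ?n\<^esub> K_grp p q"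
  define D where "D f = {A \<in> carrier_mat ?n ?n. f A \<noteq> 0}" for f :: "complex mat \<Rightarrow> complex"
  have "topspace (ztop (matrix_space ?n)) = \<Union>{D f | f. poly_fun ?n f}"
    by (simp only: matrix_space_def Let_def fun_space.simps topology_generated_by_topspace D_def)
  also have "\<dots> = carrier_mat ?n ?n"
  proof (rule subset_antisym)
    show "\<Union>{D f | f. poly_fun ?n f} \<subseteq> carrier_mat ?n ?n"
      by (rule Union_least) (auto simp: D_def)
    have one: "D (\<lambda>_. 1) \<in> {D f | f. poly_fun ?n f}"
      by (intro CollectI exI[of _ "\<lambda>_. 1"] conjI refl poly_fun.const)
    have "D (\<lambda>_. 1) = carrier_mat ?n ?n"
      by (simp add: D_def)
    then show "carrier_mat ?n ?n \<subseteq> \<Union>{D f | f. poly_fun ?n f}"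
      using Union_upper[OF one] by (simp only:)
  qed
  finally have "topspace (ztop (matrix_space ?n)) = carrier_mat ?n ?n" .
  moreover have "carrier (GL ?n) \<subseteq> carrier_mat ?n ?n"
    unfolding GL_def units_of_carrier Units_def ring_mat_simps by (rule subsetI) (erule CollectE, erule conjunct1)
  ultimately have Y: "topspace (ztop ?Y) = carrier (GL ?n)"
    by (simp add: fs_subspace_def Int_absorb1)
  have quot: "topspace (ztop (fs_quotient X f)) = f ` topspace (ztop X)"
    for X :: "complex mat fun_space" and f :: "complex mat \<Rightarrow> complex mat set"
  proof (rule subset_antisym)
    show "topspace (ztop (fs_quotient X f)) \<subseteq> f ` topspace (ztop X)"
      using openin_topspace[of "ztop (fs_quotient X f)"] unfolding openin_fs_quotient by (rule conjunct1)
    have "{x \<in> topspace (ztop X). f x \<in> f ` topspace (ztop X)} = topspace (ztop X)"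
      by auto
    then have "openin (ztop (fs_quotient X f)) (f ` topspace (ztop X))"
      by (simp add: openin_fs_quotient)
    then show "f ` topspace (ztop X) \<subseteq> topspace (ztop (fs_quotient X f))"
      by (rule openin_subset)
  qed
  show ?thesis
    unfolding GL_mod_K_def Let_def quot Y LCOSETS_def UNION_singleton_eq_range ..
qed

section \<open>Clans\<close>

text \<open>
  Vertices, rows and columns are numbered from \<open>0\<close>, as matrix indices are in
  \<^theory>\<open>Jordan_Normal_Form.Matrix\<close>. A clan is given by its \<open>+\<close> vertices, its \<open>-\<close> vertices and its
  matchings \<open>(i, j)\<close> with \<open>i < j\<close>; so clans differing only by a renaming of the natural numbers in
  the string notation are equal.
\<close>

record clan =
  pluses :: "nat set"
  minuses :: "nat set"
  matchings :: "(nat \<times> nat) set"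

definition clans :: "nat \<Rightarrow> nat \<Rightarrow> clan set" where
  "clans p q = {\<alpha>.
     matchings \<alpha> \<subseteq> {(i, j). i < j \<and> j < p + q} \<and>
     (\<forall>m\<in>matchings \<alpha>. \<forall>m'\<in>matchings \<alpha>. m \<noteq> m' \<longrightarrow> {fst m, snd m} \<inter> {fst m', snd m'} = {}) \<and>
     pluses \<alpha> \<inter> minuses \<alpha> = {} \<and>
     pluses \<alpha> \<union> minuses \<alpha> = {..<p + q} - (\<Union>m\<in>matchings \<alpha>. {fst m, snd m}) \<and>
     int (card (pluses \<alpha>)) - int (card (minuses \<alpha>)) = int p - int q}"

definition lefts :: "clan \<Rightarrow> nat set" where
  "lefts \<alpha> = fst ` matchings \<alpha>"

text \<open>
  The permutation \<open>w\<^sub>\<alpha>\<close> (with values \<open>0, \<dots>, n - 1\<close>). The first \<open>p\<close> values go in increasing order to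
  the \<open>+\<close>'s and the left ends. The remaining values are handed out in increasing order, one for each
  \<open>-\<close> or left end met from left to right; the one triggered by a left end goes to its right end.
\<close>

definition w_clan :: "nat \<Rightarrow> clan \<Rightarrow> nat \<Rightarrow> nat" where
  "w_clan p \<alpha> i =
     (if i \<in> pluses \<alpha> \<union> lefts \<alpha> then card {k \<in> pluses \<alpha> \<union> lefts \<alpha>. k < i}
      else if i \<in> minuses \<alpha> then p + card {k \<in> minuses \<alpha> \<union> lefts \<alpha>. k < i}
      else p + card {k \<in> minuses \<alpha> \<union> lefts \<alpha>. k < (THE l. (l, i) \<in> matchings \<alpha>)})"

section \<open>The generic matrix and the affine space\<close>

definition has_one :: "nat \<Rightarrow> clan \<Rightarrow> nat \<Rightarrow> nat \<Rightarrow> bool" where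
  "has_one p \<alpha> r c \<longleftrightarrow>
     (r \<in> pluses \<alpha> \<union> minuses \<alpha> \<and> c = w_clan p \<alpha> r) \<or>
     (\<exists>j. (r, j) \<in> matchings \<alpha> \<and> (c = w_clan p \<alpha> r \<or> c = w_clan p \<alpha> j)) \<or>
     (\<exists>j. (j, r) \<in> matchings \<alpha> \<and> c = w_clan p \<alpha> r)"

definition has_minus_one :: "nat \<Rightarrow> clan \<Rightarrow> nat \<Rightarrow> nat \<Rightarrow> bool" where
  "has_minus_one p \<alpha> r c \<longleftrightarrow> (\<exists>j. (j, r) \<in> matchings \<alpha> \<and> c = w_clan p \<alpha> j)"

definition pivot :: "nat \<Rightarrow> clan \<Rightarrow> nat \<Rightarrow> nat" where
  "pivot p \<alpha> c = (LEAST r. has_one p \<alpha> r c)"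

text \<open>
  An entry is annihilated by a pivot in its row only if that pivot lies in the same block of columns
  (first \<open>p\<close> or last \<open>q\<close>). For example, the row of a \<open>-\<close> has its pivot in the last \<open>q\<close>
  columns, and its entries in the first \<open>p\<close> columns are not annihilated by it.
\<close>

definition zero_first :: "nat \<Rightarrow> nat \<Rightarrow> clan \<Rightarrow> nat \<Rightarrow> nat \<Rightarrow> bool" where
  "zero_first p q \<alpha> r c \<longleftrightarrow> c < p \<and>
     ((\<exists>d<p. pivot p \<alpha> d = r) \<or>
      r < pivot p \<alpha> c \<or>
      (\<exists>s. has_minus_one p \<alpha> s c \<and> pivot p \<alpha> c < r \<and> r < s) \<or>
      (\<exists>d<c. has_minus_one p \<alpha> r d))"

definition zero_last :: "nat \<Rightarrow> nat \<Rightarrow> clan \<Rightarrow> nat \<Rightarrow> nat \<Rightarrow> bool" where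
  "zero_last p q \<alpha> r c \<longleftrightarrow> p \<le> c \<and> c < p + q \<and>
     ((\<exists>d\<in>{p..<p + q}. pivot p \<alpha> d = r) \<or>
      r < pivot p \<alpha> c \<or>
      (\<exists>s. has_one p \<alpha> s c \<and> pivot p \<alpha> c < r \<and> r < s) \<or>
      (\<exists>d\<in>{p..<c}. has_one p \<alpha> r d \<and> pivot p \<alpha> d < r))"

text \<open>
  \<open>dependent p \<alpha> l c i\<close>: a crossing of matchings \<open>(i, k)\<close> and \<open>(j, l)\<close> ties the entry at
  \<open>(l, c)\<close>, where \<open>c = w\<^sub>\<alpha>(k)\<close>, to the entry at \<open>(l, w\<^sub>\<alpha>(i))\<close>.
\<close>

definition dependent :: "nat \<Rightarrow> clan \<Rightarrow> nat \<Rightarrow> nat \<Rightarrow> nat \<Rightarrow> bool" where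
  "dependent p \<alpha> l c i \<longleftrightarrow>
     (\<exists>j k. (i, k) \<in> matchings \<alpha> \<and> (j, l) \<in> matchings \<alpha> \<and> i < j \<and> j < k \<and> k < l \<and>
            c = w_clan p \<alpha> k)"

definition generic_matrix :: "nat \<Rightarrow> nat \<Rightarrow> clan \<Rightarrow> (nat \<Rightarrow> nat \<Rightarrow> complex) \<Rightarrow> complex mat" where
  "generic_matrix p q \<alpha> z = mat (p + q) (p + q) (\<lambda>(r, c).
     if has_one p \<alpha> r c then 1
     else if has_minus_one p \<alpha> r c then - 1
     else if zero_first p q \<alpha> r c \<or> zero_last p q \<alpha> r c then 0
     else if \<exists>i. dependent p \<alpha> r c i then - z r (w_clan p \<alpha> (THE i. dependent p \<alpha> r c i))
     else z r c)"

definition S_clan :: "nat \<Rightarrow> nat \<Rightarrow> clan \<Rightarrow> complex mat set" where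
  "S_clan p q \<alpha> = range (generic_matrix p q \<alpha>)"

definition x_clan :: "nat \<Rightarrow> nat \<Rightarrow> clan \<Rightarrow> complex mat" where
  "x_clan p q \<alpha> = generic_matrix p q \<alpha> (\<lambda>_ _. 0)"

definition S_variety :: "nat \<Rightarrow> nat \<Rightarrow> clan \<Rightarrow> complex mat fun_space" where
  "S_variety p q \<alpha> = fs_subspace (matrix_space (p + q)) (S_clan p q \<alpha>)"

section \<open>The Mars--Springer slice\<close>

text \<open>
  \<open>\<eta>\<close> is represented by \<open>x \<theta>(x)\<^sup>-\<^sup>1\<close> itself. Replacing this by another representative multiplies it
  by a diagonal matrix \<open>t\<close>, and \<open>t U\<^sup>- t\<^sup>-\<^sup>1 = U\<^sup>-\<close>, so \<open>\<psi>(U\<^sup>-)\<close> does not change.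
\<close>

definition eta_rep :: "nat \<Rightarrow> nat \<Rightarrow> clan \<Rightarrow> complex mat" where
  "eta_rep p q \<alpha> = x_clan p q \<alpha> * inv\<^bsub>GL (p + q)\<^esub> (theta p q (x_clan p q \<alpha>))"

definition psi :: "nat \<Rightarrow> nat \<Rightarrow> clan \<Rightarrow> complex mat \<Rightarrow> complex mat" where
  "psi p q \<alpha> g = eta_rep p q \<alpha> * theta p q g * inv\<^bsub>GL (p + q)\<^esub> (eta_rep p q \<alpha>)"

definition slice :: "nat \<Rightarrow> nat \<Rightarrow> clan \<Rightarrow> complex mat set set" where
  "slice p q \<alpha> = {(u * x_clan p q \<alpha>) <#\<^bsub>GL (p + q)\<^esub> K_grp p q | u.
                    u \<in> U_minus (p + q) \<inter> psi p q \<alpha> ` U_minus (p + q)}"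

definition slice_variety :: "nat \<Rightarrow> nat \<Rightarrow> clan \<Rightarrow> complex mat set fun_space" where
  "slice_variety p q \<alpha> = fs_subspace (GL_mod_K p q) (slice p q \<alpha>)"

end

theory Submission
  imports Defs "Jordan_Normal_Form.Determinant"
begin

text \<open>
  Let \<open>x\<close> be the base point and \<open>I = I_pq p q\<close>. In terms of columns, \<open>x\<close> sends the two basis
  vectors of a matching \<open>(i, j)\<close> to \<open>e\<^sub>i - e\<^sub>j\<close> and \<open>e\<^sub>i + e\<^sub>j\<close>, and the basis vector of an unmatched
  vertex \<open>i\<close> to \<open>e\<^sub>i\<close>. So \<open>s = x I x\<inverse>\<close> is a signed permutation matrix, for the involution
  \<open>partner\<close> that exchanges the ends of each matching, and \<open>\<eta>\<close> is represented by \<open>s I\<close>. Hence \<open>\<psi>\<close> is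
  conjugation by \<open>s\<close>, and \<open>U = U\<^sup>- \<inter> \<psi>(U\<^sup>-)\<close> consists of the unipotent matrices with support in
  the positions \<open>(r, c)\<close> such that \<open>c \<le> r\<close> and \<open>partner c \<le> partner r\<close> (\<open>dominates\<close>).

  For any \<open>g\<close>, let \<open>pivot_block g\<close> be the block diagonal matrix whose blocks are cut out of the first
  \<open>p\<close> and of the last \<open>q\<close> columns of \<open>g\<close> by the pivot rows of these columns. Right multiplication of
  \<open>g\<close> by \<open>k \<in> K\<close> multiplies \<open>pivot_block g\<close> by \<open>k\<close>. So \<open>normal_form g = g (pivot_block g)\<inverse>\<close> is a
  rational map that is constant on cosets of \<open>K\<close>, and each coset contains at most one matrix with
  pivot block \<open>1\<close>.

  The heart of the proof is that \<open>S_clan\<close> is the set of all \<open>u x\<close> with \<open>u \<in> U\<close> and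
  \<open>pivot_block (u x) = 1\<close> (lemmas \<open>S_clan_factorization\<close> and \<open>S_clanI\<close>). The prescribed entries in
  the rows of pivots say that the pivot block is \<open>1\<close>. The other conditions say that \<open>M x\<inverse>\<close> is in
  \<open>U\<close>: its columns at the ends of a matching are half the sum and half the difference of two columns of
  \<open>M\<close>. The fixed entries \<open>- 1\<close> and \<open>1\<close> and the sign rule for crossing matchings make the sum vanish
  at the positions that are admissible for the right end but not for the left end.

  It remains to see that every coset \<open>u x K\<close> with \<open>u \<in> U\<close> contains a point of \<open>S_clan\<close>. Put
  \<open>h = x (pivot_block (u x)) x\<inverse>\<close>. A computation of its entries shows that \<open>h\<close> is again in \<open>U\<close>
  (lemma \<open>stabilizer_part_U_clan\<close>). So the pivot block is invertible, and
  \<open>normal_form (u x) = (u h\<inverse>) x\<close> has pivot block \<open>1\<close> and is in \<open>U x\<close>, hence in \<open>S_clan\<close>. Thus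
  \<open>M \<mapsto> M K\<close> and \<open>g K \<mapsto> normal_form g\<close> are inverse to each other, and both are morphisms
  (lemma \<open>isomorphic_by_canonical_form\<close>).
\<close>

section \<open>General linear groups\<close>

lemma carrier_GL_iff: "A \<in> carrier (GL n) \<longleftrightarrow> A \<in> carrier_mat n n \<and> det A \<noteq> 0"
proof
  assume A: "A \<in> carrier (GL n)"
  then have "A \<in> Units (ring_mat TYPE(complex) n ())"
    by (simp add: GL_def units_of_carrier)
  then show "A \<in> carrier_mat n n \<and> det A \<noteq> 0"
    using unit_imp_det_non_zero by (auto simp: Units_def ring_mat_simps)
qed (simp add: GL_def units_of_carrier det_non_zero_imp_unit)

lemma group_GL: "group (GL n)"
  unfolding GL_def by (rule monoid.units_group[OF ring.is_monoid[OF ring_mat]])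

lemma GL_simps [simp]: "A \<otimes>\<^bsub>GL n\<^esub> B = A * B" "\<one>\<^bsub>GL n\<^esub> = 1\<^sub>m n"
  by (simp_all add: GL_def units_of_mult units_of_one ring_mat_simps)

lemma GL_inv:
  assumes "A \<in> carrier (GL n)"
  shows "inv\<^bsub>GL n\<^esub> A \<in> carrier (GL n)" "inv\<^bsub>GL n\<^esub> A \<in> carrier_mat n n"
    "A * inv\<^bsub>GL n\<^esub> A = 1\<^sub>m n" "inv\<^bsub>GL n\<^esub> A * A = 1\<^sub>m n"
proof -
  interpret group "GL n" by (rule group_GL)
  show i: "inv\<^bsub>GL n\<^esub> A \<in> carrier (GL n)" using assms by simp
  then show "inv\<^bsub>GL n\<^esub> A \<in> carrier_mat n n" by (simp add: carrier_GL_iff)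
  show "A * inv\<^bsub>GL n\<^esub> A = 1\<^sub>m n" "inv\<^bsub>GL n\<^esub> A * A = 1\<^sub>m n"
    using r_inv[OF assms] l_inv[OF assms] by simp_all
qed

lemma GL_of_left_inverse:
  assumes "A \<in> carrier_mat n n" "B \<in> carrier_mat n n" "B * A = 1\<^sub>m n"
  shows "A \<in> carrier (GL n)" "B \<in> carrier (GL n)" "inv\<^bsub>GL n\<^esub> A = B"
proof -
  have "det B * det A = 1"
    using assms det_mult[of B n A] by simp
  then show AB: "A \<in> carrier (GL n)" "B \<in> carrier (GL n)"
    using assms by (auto simp: carrier_GL_iff)
  show "inv\<^bsub>GL n\<^esub> A = B"
    using group.inv_equality[OF group_GL, where y = B and x = A] AB assms(3) by simp
qed

lemma GL_mult: "A \<in> carrier (GL n) \<Longrightarrow> B \<in> carrier (GL n) \<Longrightarrow> A * B \<in> carrier (GL n)"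
  by (auto simp: carrier_GL_iff det_mult)

lemma mult_assoc_square:
  "A \<in> carrier_mat n n \<Longrightarrow> B \<in> carrier_mat n n \<Longrightarrow> C \<in> carrier_mat n n \<Longrightarrow>
     A * B * C = A * (B * C)"
  by (rule assoc_mult_mat)

section \<open>\<open>K\<close> as a centralizer\<close>

definition off_block_zero :: "nat \<Rightarrow> nat \<Rightarrow> complex mat \<Rightarrow> bool" where
  "off_block_zero p n k \<longleftrightarrow> (\<forall>a<n. \<forall>b<n. (a < p) \<noteq> (b < p) \<longrightarrow> k $$ (a, b) = 0)"

lemma K_grp_iff: "k \<in> K_grp p q \<longleftrightarrow> k \<in> carrier (GL (p + q)) \<and> off_block_zero p (p + q) k"
proof
  assume "k \<in> K_grp p q"
  then obtain A D where AD: "k = four_block_mat A (0\<^sub>m p q) (0\<^sub>m q p) D"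
    "A \<in> carrier_mat p p" "det A \<noteq> 0" "D \<in> carrier_mat q q" "det D \<noteq> 0"
    by (auto simp: K_grp_def carrier_GL_iff)
  then have "det k = det A * det D"
    using det_four_block_mat_upper_right_zero[of A p "0\<^sub>m p q" q "0\<^sub>m q p" D] by simp
  with AD show "k \<in> carrier (GL (p + q)) \<and> off_block_zero p (p + q) k"
    by (auto simp: carrier_GL_iff off_block_zero_def)
next
  assume k: "k \<in> carrier (GL (p + q)) \<and> off_block_zero p (p + q) k"
  obtain A B C D where s: "split_block k p p = (A, B, C, D)"
    by (metis prod_cases4)
  note b = split_block[OF s, of q q]
  have kc: "k \<in> carrier_mat (p + q) (p + q)" using k by (simp add: carrier_GL_iff)
  then have dims: "dim_row k = p + q" "dim_col k = p + q" by auto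
  note b = b[OF this]
  have B: "B = 0\<^sub>m p q"
    using s k dims by (auto simp: split_block_def Let_def off_block_zero_def)
  have C: "C = 0\<^sub>m q p"
    using s k dims by (auto simp: split_block_def Let_def off_block_zero_def)
  have "det k = det A * det D"
    using det_four_block_mat_upper_right_zero[of A p "0\<^sub>m p q" q "0\<^sub>m q p" D] b B C by simp
  then show "k \<in> K_grp p q"
    using b k B C by (auto simp: K_grp_def carrier_GL_iff)
qed

lemma I_pq_carrier [simp]: "I_pq p q \<in> carrier_mat (p + q) (p + q)"
  by (simp add: I_pq_def)

lemma I_pq_entry:
  "a < p + q \<Longrightarrow> b < p + q \<Longrightarrow> I_pq p q $$ (a, b) = (if a = b then if a < p then 1 else - 1 else 0)"
  by (auto simp: I_pq_def)

lemma mult_entry: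
  "A \<in> carrier_mat n n \<Longrightarrow> B \<in> carrier_mat n n \<Longrightarrow> a < n \<Longrightarrow> b < n \<Longrightarrow>
     (A * B) $$ (a, b) = (\<Sum>c<n. A $$ (a, c) * B $$ (c, b))"
  by (auto simp: scalar_prod_def lessThan_atLeast0 intro!: sum.cong)

lemma mult_I_pq_right:
  assumes "k \<in> carrier_mat (p + q) (p + q)" "a < p + q" "b < p + q"
  shows "(k * I_pq p q) $$ (a, b) = (if b < p then 1 else - 1) * k $$ (a, b)"
proof -
  have "(k * I_pq p q) $$ (a, b) = (\<Sum>c<p + q. k $$ (a, c) * I_pq p q $$ (c, b))"
    using assms by (simp add: mult_entry[of _ "p + q"])
  also have "\<dots> = (\<Sum>c<p + q. if c = b then (if b < p then 1 else - 1) * k $$ (a, b) else 0)"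
    using assms by (intro sum.cong) (auto simp: I_pq_entry)
  finally show ?thesis using assms by simp
qed

lemma mult_I_pq_left:
  assumes "k \<in> carrier_mat (p + q) (p + q)" "a < p + q" "b < p + q"
  shows "(I_pq p q * k) $$ (a, b) = (if a < p then 1 else - 1) * k $$ (a, b)"
proof -
  have "(I_pq p q * k) $$ (a, b) = (\<Sum>c<p + q. I_pq p q $$ (a, c) * k $$ (c, b))"
    using assms by (simp add: mult_entry[of _ "p + q"])
  also have "\<dots> = (\<Sum>c<p + q. if c = a then (if a < p then 1 else - 1) * k $$ (a, b) else 0)"
    using assms by (intro sum.cong) (auto simp: I_pq_entry)
  finally show ?thesis using assms by simp
qed

lemma I_pq_square: "I_pq p q * I_pq p q = 1\<^sub>m (p + q)"
proof (rule eq_matI)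
  fix a b assume "a < dim_row (1\<^sub>m (p + q) :: complex mat)" "b < dim_col (1\<^sub>m (p + q) :: complex mat)"
  then have ab: "a < p + q" "b < p + q" by auto
  show "(I_pq p q * I_pq p q) $$ (a, b) = 1\<^sub>m (p + q) $$ (a, b)"
    unfolding mult_I_pq_left[OF I_pq_carrier ab] using ab by (simp add: I_pq_entry)
qed (simp_all add: I_pq_def)

text \<open>
  Commuting with an involution is inherited by inverses; this is how the block form of \<open>K\<close> passes to
  inverses.
\<close>

lemma off_block_zero_iff_commute:
  assumes "k \<in> carrier_mat (p + q) (p + q)"
  shows "off_block_zero p (p + q) k \<longleftrightarrow> k * I_pq p q = I_pq p q * k"
proof
  assume o: "off_block_zero p (p + q) k"
  show "k * I_pq p q = I_pq p q * k"
  proof (rule eq_matI)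
    fix a b assume "a < dim_row (I_pq p q * k)" "b < dim_col (I_pq p q * k)"
    then have ab: "a < p + q" "b < p + q" using assms I_pq_carrier[of p q] by auto
    show "(k * I_pq p q) $$ (a, b) = (I_pq p q * k) $$ (a, b)"
      unfolding mult_I_pq_left[OF assms ab] mult_I_pq_right[OF assms ab]
      using o ab by (auto simp: off_block_zero_def)
  qed (use assms in \<open>auto simp: I_pq_def\<close>)
next
  assume e: "k * I_pq p q = I_pq p q * k"
  show "off_block_zero p (p + q) k"
    unfolding off_block_zero_def
  proof (intro allI impI)
    fix a b assume ab: "a < p + q" "b < p + q" and "(a < p) \<noteq> (b < p)"
    then show "k $$ (a, b) = 0"
      using mult_I_pq_left[OF assms ab] mult_I_pq_right[OF assms ab] e by (auto split: if_splits)
  qed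
qed

lemma off_block_zero_inv:
  assumes k: "k \<in> carrier (GL (p + q))" "off_block_zero p (p + q) k"
  shows "off_block_zero p (p + q) (inv\<^bsub>GL (p + q)\<^esub> k)"
proof -
  let ?h = "inv\<^bsub>GL (p + q)\<^esub> k" and ?I = "I_pq p q"
  note h = GL_inv[OF k(1)] 
  have kc: "k \<in> carrier_mat (p + q) (p + q)" using k by (simp add: carrier_GL_iff)
  have e: "k * ?I = ?I * k" using k(2) off_block_zero_iff_commute[OF kc] by simp
  have "?h * ?I = ?h * ?I * (k * ?h)"
    unfolding h(3) using h(2) by (simp add: right_mult_one_mat[of _ "p + q"])
  also have "\<dots> = ?h * (?I * k) * ?h"
    using kc h(2) I_pq_carrier[of p q]
    by (simp add: mult_assoc_square[of _ "p + q"] mult_carrier_mat[of _ "p + q" "p + q"])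
  also have "\<dots> = ?h * (k * ?I) * ?h" by (simp add: e)
  also have "\<dots> = (?h * k) * ?I * ?h"
    using kc h(2) I_pq_carrier[of p q]
    by (simp add: mult_assoc_square[of _ "p + q"] mult_carrier_mat[of _ "p + q" "p + q"])
  also have "\<dots> = ?I * ?h" by (simp add: h(4) left_mult_one_mat[of _ "p + q" "p + q"])
  finally show ?thesis using off_block_zero_iff_commute h(2) by blast
qed

lemma K_grp_inv: "k \<in> K_grp p q \<Longrightarrow> inv\<^bsub>GL (p + q)\<^esub> k \<in> K_grp p q"
  by (simp add: K_grp_iff off_block_zero_inv GL_inv)

lemma K_grp_mult:
  assumes "k \<in> K_grp p q" "h \<in> K_grp p q"
  shows "k * h \<in> K_grp p q"
proof -
  have "(k * h) $$ (a, b) = 0" if ab: "a < p + q" "b < p + q" "(a < p) \<noteq> (b < p)" for a b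
  proof -
    have "(k * h) $$ (a, b) = (\<Sum>c<p + q. k $$ (a, c) * h $$ (c, b))"
      using assms ab by (simp add: mult_entry[of _ "p + q"] K_grp_iff carrier_GL_iff)
    also have "\<dots> = 0"
      using assms ab by (intro sum.neutral) (auto simp: K_grp_iff off_block_zero_def)
    finally show ?thesis .
  qed
  then show ?thesis
    using assms GL_mult by (auto simp: K_grp_iff off_block_zero_def)
qed

lemma K_grp_one: "1\<^sub>m (p + q) \<in> K_grp p q"
  by (auto simp: K_grp_iff carrier_GL_iff off_block_zero_def)

lemma coset_eq: "g <#\<^bsub>GL n\<^esub> H = {g * k | k. k \<in> H}"
  by (auto simp: l_coset_def)

lemma coset_self: "g \<in> carrier (GL (p + q)) \<Longrightarrow> g \<in> g <#\<^bsub>GL (p + q)\<^esub> K_grp p q"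
  unfolding coset_eq carrier_GL_iff
  by (intro CollectI exI[of _ "1\<^sub>m (p + q)"] conjI K_grp_one) (simp add: right_mult_one_mat[of _ "p + q"])

lemma coset_mult_K:
  assumes "g \<in> carrier (GL (p + q))" "k \<in> K_grp p q"
  shows "(g * k) <#\<^bsub>GL (p + q)\<^esub> K_grp p q = g <#\<^bsub>GL (p + q)\<^esub> K_grp p q"
proof -
  have c: "g \<in> carrier_mat (p + q) (p + q)" "k \<in> carrier_mat (p + q) (p + q)"
    "\<And>h. h \<in> K_grp p q \<Longrightarrow> h \<in> carrier_mat (p + q) (p + q)"
    using assms by (auto simp: K_grp_iff carrier_GL_iff)
  let ?k' = "inv\<^bsub>GL (p + q)\<^esub> k"
  have k': "?k' \<in> K_grp p q" "k * ?k' = 1\<^sub>m (p + q)"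
    using assms GL_inv[of k "p + q"] K_grp_inv by (auto simp: K_grp_iff)
  show ?thesis
    unfolding coset_eq
  proof (intro subset_antisym subsetI)
    fix y assume "y \<in> {g * k * h | h. h \<in> K_grp p q}"
    then obtain h where "h \<in> K_grp p q" "y = g * k * h" by blast
    then have "y = g * (k * h)" "k * h \<in> K_grp p q"
      using c assms K_grp_mult by (auto simp: mult_assoc_square[of g "p + q"])
    then show "y \<in> {g * h | h. h \<in> K_grp p q}" by blast
  next
    fix y assume "y \<in> {g * h | h. h \<in> K_grp p q}"
    then obtain h where h: "h \<in> K_grp p q" "y = g * h" by blast
    have "g * k * (?k' * h) = g * (k * ?k') * h"
      using c h k'(1) by (simp add: mult_assoc_square[of _ "p + q"] mult_carrier_mat[of _ "p + q" "p + q"])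
    then have "y = g * k * (?k' * h)"
      using c(1) h(2) k'(2) by (simp add: right_mult_one_mat[of _ "p + q"])
    moreover have "?k' * h \<in> K_grp p q"
      using h k' K_grp_mult by auto
    ultimately show "y \<in> {g * k * h | h. h \<in> K_grp p q}" by blast
  qed
qed

section \<open>Regular maps between open sets of matrices\<close>

lemma poly_fun_sum: "(\<And>i. i \<in> I \<Longrightarrow> poly_fun n (f i)) \<Longrightarrow> poly_fun n (\<lambda>A. \<Sum>i\<in>I. f i A)"
  by (induction I rule: infinite_finite_induct) (auto intro: poly_fun.intros)

lemma poly_fun_prod: "(\<And>i. i \<in> I \<Longrightarrow> poly_fun n (f i)) \<Longrightarrow> poly_fun n (\<lambda>A. \<Prod>i\<in>I. f i A)"
  by (induction I rule: infinite_finite_induct) (auto intro: poly_fun.intros)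

lemma poly_fun_power: "poly_fun n f \<Longrightarrow> poly_fun n (\<lambda>A. f A ^ k)"
  by (induction k) (auto intro: poly_fun.intros)

lemma poly_fun_det:
  assumes "\<And>i j. i < m \<Longrightarrow> j < m \<Longrightarrow> poly_fun n (\<lambda>A. g A i j)"
  shows "poly_fun n (\<lambda>A. det (mat m m (\<lambda>(i, j). g A i j)))"
proof -
  have "det (mat m m (\<lambda>(i, j). g A i j)) =
      (\<Sum>s\<in>{s. s permutes {0..<m}}. signof s * (\<Prod>i\<in>{0..<m}. g A i (s i)))" for A
    by (subst det_def'[of _ m]) (auto intro!: sum.cong prod.cong dest: permutes_in_image)
  moreover have "poly_fun n (\<lambda>A. \<Sum>s\<in>{s. s permutes {0..<m}}. signof s * (\<Prod>i\<in>{0..<m}. g A i (s i)))"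
    using assms by (intro poly_fun_sum poly_fun.mult poly_fun.const poly_fun_prod)
      (auto dest: permutes_in_image)
  ultimately show ?thesis by simp
qed

lemma poly_fun_adj_mat:
  assumes "\<And>i j. i < m \<Longrightarrow> j < m \<Longrightarrow> poly_fun n (\<lambda>A. g A i j)" and ij: "i < m" "j < m"
  shows "poly_fun n (\<lambda>A. adj_mat (mat m m (\<lambda>(i, j). g A i j)) $$ (i, j))"
proof -
  let ?h = "\<lambda>A a b. g A (if a < j then a else Suc a) (if b < i then b else Suc b)"
  have "mat_delete (mat m m (\<lambda>(i, j). g A i j)) j i = mat (m - 1) (m - 1) (\<lambda>(a, b). ?h A a b)" for A
    by (rule eq_matI) (auto simp: mat_delete_def)
  then have "adj_mat (mat m m (\<lambda>(i, j). g A i j)) $$ (i, j) =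
      (- 1) ^ (j + i) * det (mat (m - 1) (m - 1) (\<lambda>(a, b). ?h A a b))" for A
    using ij by (simp add: adj_mat_def cofactor_def)
  moreover have "poly_fun n (\<lambda>A. (- 1) ^ (j + i) * det (mat (m - 1) (m - 1) (\<lambda>(a, b). ?h A a b)))"
    using assms by (intro poly_fun.mult poly_fun.const poly_fun_det) auto
  ultimately show ?thesis by simp
qed

definition principal_open :: "nat \<Rightarrow> (complex mat \<Rightarrow> complex) \<Rightarrow> complex mat set" where
  "principal_open n f = {A \<in> carrier_mat n n. f A \<noteq> 0}"

lemma ztop_matrix_space:
  "ztop (matrix_space n) = topology_generated_by {principal_open n f | f. poly_fun n f}"
  by (simp add: matrix_space_def Let_def principal_open_def)

lemma openin_principal_open: "poly_fun n f \<Longrightarrow> openin (ztop (matrix_space n)) (principal_open n f)"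
  unfolding ztop_matrix_space by (intro topology_generated_by_Basis) auto

lemma topspace_matrix_space: "topspace (ztop (matrix_space n)) = carrier_mat n n"
proof -
  have "principal_open n (\<lambda>_. 1) = carrier_mat n n" by (simp add: principal_open_def)
  moreover have "poly_fun n (\<lambda>_. 1)" by (rule poly_fun.const)
  ultimately have "carrier_mat n n \<in> {principal_open n f | f. poly_fun n f}" by force
  then show ?thesis
    unfolding ztop_matrix_space topology_generated_by_topspace by (auto simp: principal_open_def)
qed

lemma regular_matrix_space:
  "regular (matrix_space n) U f \<longleftrightarrow>
     (\<forall>A\<in>U. \<exists>W a b. openin (ztop (matrix_space n)) W \<and> A \<in> W \<and> W \<subseteq> U \<and>
        poly_fun n a \<and> poly_fun n b \<and> (\<forall>C\<in>W. b C \<noteq> 0 \<and> f C = a C / b C))"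
  by (simp add: matrix_space_def Let_def)

lemma regular_matrix_spaceE:
  assumes "regular (matrix_space n) U f" "A \<in> U"
  obtains W a b where "openin (ztop (matrix_space n)) W" "A \<in> W" "W \<subseteq> U"
    "poly_fun n a" "poly_fun n b" "\<forall>C\<in>W. b C \<noteq> 0 \<and> f C = a C / b C"
  using bspec[OF assms(1)[unfolded regular_matrix_space] assms(2)] by (elim exE conjE)

lemma regular_matrix_spaceI:
  assumes "\<And>A. A \<in> U \<Longrightarrow> \<exists>W a b. openin (ztop (matrix_space n)) W \<and> A \<in> W \<and> W \<subseteq> U \<and>
        poly_fun n a \<and> poly_fun n b \<and> (\<forall>C\<in>W. b C \<noteq> 0 \<and> f C = a C / b C)"
  shows "regular (matrix_space n) U f"
  unfolding regular_matrix_space using assms by (rule ballI)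

lemma regular_matrix_space_subset:
  assumes r: "regular (matrix_space n) U f" and V: "openin (ztop (matrix_space n)) V" "V \<subseteq> U"
    and eq: "\<And>A. A \<in> V \<Longrightarrow> f A = g A"
  shows "regular (matrix_space n) V g"
proof (rule regular_matrix_spaceI)
  fix A assume A: "A \<in> V"
  with V(2) have "A \<in> U" by (rule subsetD)
  with r obtain W a b where W: "openin (ztop (matrix_space n)) W" "A \<in> W" "W \<subseteq> U"
    "poly_fun n a" "poly_fun n b" "\<forall>C\<in>W. b C \<noteq> 0 \<and> f C = a C / b C"
    by (rule regular_matrix_spaceE)
  show "\<exists>W a b. openin (ztop (matrix_space n)) W \<and> A \<in> W \<and> W \<subseteq> V \<and>
        poly_fun n a \<and> poly_fun n b \<and> (\<forall>C\<in>W. b C \<noteq> 0 \<and> g C = a C / b C)"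
  proof (intro exI conjI ballI)
    show "openin (ztop (matrix_space n)) (W \<inter> V)" using W(1) V(1) by (rule openin_Int)
    show "g C = a C / b C" if "C \<in> W \<inter> V" for C
      using W(6) eq[of C] that by simp
  qed (use A W in auto)
qed

lemma regular_fs_subspace:
  "regular (fs_subspace X S) V f \<longleftrightarrow>
     (\<forall>x\<in>V. \<exists>W g. openin (ztop X) W \<and> x \<in> W \<and> regular X W g \<and> (\<forall>y \<in> W \<inter> V. f y = g y))"
  by (simp add: fs_subspace_def)

lemma ztop_fs_subspace: "ztop (fs_subspace X S) = subtopology (ztop X) S"
  by (simp add: fs_subspace_def)

lemma regular_open_subspace:
  assumes "openin (ztop (matrix_space n)) V"
  shows "regular (fs_subspace (matrix_space n) S) V f \<longleftrightarrow> regular (matrix_space n) V f"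
proof
  assume l: "regular (fs_subspace (matrix_space n) S) V f"
  show "regular (matrix_space n) V f"
  proof (rule regular_matrix_spaceI)
    fix A assume A: "A \<in> V"
    from bspec[OF l[unfolded regular_fs_subspace] A] obtain W g where
      W: "openin (ztop (matrix_space n)) W" "A \<in> W" "regular (matrix_space n) W g"
      and eq: "\<forall>y \<in> W \<inter> V. f y = g y"
      by (elim exE conjE)
    have o: "openin (ztop (matrix_space n)) (W \<inter> V)" using W(1) assms by (rule openin_Int)
    have "regular (matrix_space n) (W \<inter> V) f"
      by (rule regular_matrix_space_subset[OF W(3) o]) (use eq in auto)
    then obtain W' a b where W': "openin (ztop (matrix_space n)) W'" "A \<in> W'" "W' \<subseteq> W \<inter> V"
      "poly_fun n a" "poly_fun n b" "\<forall>C\<in>W'. b C \<noteq> 0 \<and> f C = a C / b C"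
      by (rule regular_matrix_spaceE[where A = A]) (use A W(2) in auto)
    then show "\<exists>W a b. openin (ztop (matrix_space n)) W \<and> A \<in> W \<and> W \<subseteq> V \<and>
        poly_fun n a \<and> poly_fun n b \<and> (\<forall>C\<in>W. b C \<noteq> 0 \<and> f C = a C / b C)"
      by (intro exI[of _ W'] exI[of _ a] exI[of _ b]) auto
  qed
next
  assume "regular (matrix_space n) V f"
  with assms show "regular (fs_subspace (matrix_space n) S) V f"
    unfolding regular_fs_subspace by (intro ballI exI[of _ V] exI[of _ f]) simp
qed

text \<open>
  Only powers of the one denominator \<open>d\<close> are admitted, so that the functions form a ring and all of
  them are defined on the same principal open set.
\<close>

definition rational_over :: "nat \<Rightarrow> (complex mat \<Rightarrow> complex) \<Rightarrow> (complex mat \<Rightarrow> complex) \<Rightarrow> bool" where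
  "rational_over n d f \<longleftrightarrow>
     (\<exists>a k. poly_fun n a \<and> (\<forall>A \<in> principal_open n d. f A = a A / d A ^ k))"

lemma rational_over_comp:
  assumes f: "poly_fun n f" and d: "poly_fun n d"
    and F: "\<And>i j. i < n \<Longrightarrow> j < n \<Longrightarrow> rational_over n d (\<lambda>A. F A $$ (i, j))"
  shows "rational_over n d (\<lambda>A. f (F A))"
  using f
proof induction
  case (const a)
  show ?case
    unfolding rational_over_def
    by (rule exI[of _ "\<lambda>_. a"], rule exI[of _ 0]) (auto intro: poly_fun.const)
next
  case (entry i j)
  then show ?case using F by simp
next
  case (add f g)
  then obtain a k b l where *: "poly_fun n a" "poly_fun n b"
    "\<forall>A \<in> principal_open n d. f (F A) = a A / d A ^ k" "\<forall>A \<in> principal_open n d. g (F A) = b A / d A ^ l"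
    unfolding rational_over_def by blast
  then have "\<forall>A \<in> principal_open n d. f (F A) + g (F A) = (a A * d A ^ l + b A * d A ^ k) / d A ^ (k + l)"
    by (auto simp: principal_open_def field_simps power_add)
  moreover have "poly_fun n (\<lambda>A. a A * d A ^ l + b A * d A ^ k)"
    using * d by (intro poly_fun.add poly_fun.mult poly_fun_power)
  ultimately show ?case unfolding rational_over_def by blast
next
  case (mult f g)
  then obtain a k b l where *: "poly_fun n a" "poly_fun n b"
    "\<forall>A \<in> principal_open n d. f (F A) = a A / d A ^ k" "\<forall>A \<in> principal_open n d. g (F A) = b A / d A ^ l"
    unfolding rational_over_def by blast
  then have "\<forall>A \<in> principal_open n d. f (F A) * g (F A) = (a A * b A) / d A ^ (k + l)"
    by (auto simp: power_add)
  moreover have "poly_fun n (\<lambda>A. a A * b A)"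
    using * by (intro poly_fun.mult)
  ultimately show ?case unfolding rational_over_def by blast
qed

text \<open>
  Polynomials and quotients of polynomials pull back along \<open>F\<close> to fractions with denominators powers of
  \<open>d\<close>, and such a fraction is zero on \<open>d \<noteq> 0\<close> exactly where its numerator is.
\<close>

lemma rational_map:
  assumes d: "poly_fun n d"
    and Fc: "\<And>A. A \<in> principal_open n d \<Longrightarrow> F A \<in> carrier_mat n n"
    and F: "\<And>i j. i < n \<Longrightarrow> j < n \<Longrightarrow> rational_over n d (\<lambda>A. F A $$ (i, j))"
    and V: "openin (ztop (matrix_space n)) V"
  shows openin_rational_preimage: "openin (ztop (matrix_space n)) {A \<in> principal_open n d. F A \<in> V}"
    and regular_rational_pullback: "regular (matrix_space n) V h \<Longrightarrow>
      regular (matrix_space n) {A \<in> principal_open n d. F A \<in> V} (h \<circ> F)"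
proof -
  let ?Z = "ztop (matrix_space n)"
  have top: "topspace (subtopology ?Z (principal_open n d)) = principal_open n d"
    by (auto simp: topspace_matrix_space principal_open_def)
  have "continuous_map (subtopology ?Z (principal_open n d)) ?Z F"
    unfolding ztop_matrix_space[of n]
  proof (subst ztop_matrix_space[symmetric], rule continuous_on_generated_topo)
    show "F ` topspace (subtopology ?Z (principal_open n d)) \<subseteq> \<Union>{principal_open n f | f. poly_fun n f}"
      unfolding top topology_generated_by_topspace[symmetric] ztop_matrix_space[symmetric]
        topspace_matrix_space using Fc by auto
    fix U assume "U \<in> {principal_open n f | f. poly_fun n f}"
    then obtain f where f: "U = principal_open n f" "poly_fun n f" by blast
    obtain a k where a: "poly_fun n a" "\<And>A. A \<in> principal_open n d \<Longrightarrow> f (F A) = a A / d A ^ k"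
      using rational_over_comp[OF f(2) d F] unfolding rational_over_def by blast
    have "F -` U \<inter> topspace (subtopology ?Z (principal_open n d)) = principal_open n a \<inter> principal_open n d"
    proof -
      have "F A \<in> U \<longleftrightarrow> A \<in> principal_open n a" if A: "A \<in> principal_open n d" for A
      proof -
        have "d A \<noteq> 0" "A \<in> carrier_mat n n" using A by (simp_all add: principal_open_def)
        then show ?thesis
          using a(2)[OF A] Fc[OF A] by (simp add: f(1) principal_open_def)
      qed
      then show ?thesis unfolding top by blast
    qed
    then show "openin (subtopology ?Z (principal_open n d)) (F -` U \<inter> topspace (subtopology ?Z (principal_open n d)))"
      using openin_principal_open[OF a(1)] by (auto simp: openin_subtopology)
  qed
  note cont = this
  have pre: "openin ?Z {A \<in> principal_open n d. F A \<in> V}" if "openin ?Z V" for V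
    using openin_continuous_map_preimage[OF cont that] openin_principal_open[OF d] unfolding top
    by (rule openin_trans_full)
  show o: "openin ?Z {A \<in> principal_open n d. F A \<in> V}" by (rule pre[OF V])
  assume h: "regular (matrix_space n) V h"
  show "regular (matrix_space n) {A \<in> principal_open n d. F A \<in> V} (h \<circ> F)"
  proof (rule regular_matrix_spaceI)
    fix A assume A: "A \<in> {A \<in> principal_open n d. F A \<in> V}"
    then have "F A \<in> V" by simp
    with h obtain W a b where W: "openin ?Z W" "F A \<in> W" "W \<subseteq> V" "poly_fun n a" "poly_fun n b"
      "\<forall>C\<in>W. b C \<noteq> 0 \<and> h C = a C / b C"
      by (rule regular_matrix_spaceE)
    obtain a' k where a': "poly_fun n a'" "\<And>A. A \<in> principal_open n d \<Longrightarrow> a (F A) = a' A / d A ^ k"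
      using rational_over_comp[OF W(4) d F] unfolding rational_over_def by blast
    obtain b' l where b': "poly_fun n b'" "\<And>A. A \<in> principal_open n d \<Longrightarrow> b (F A) = b' A / d A ^ l"
      using rational_over_comp[OF W(5) d F] unfolding rational_over_def by blast
    show "\<exists>W a b. openin ?Z W \<and> A \<in> W \<and> W \<subseteq> {A \<in> principal_open n d. F A \<in> V} \<and>
        poly_fun n a \<and> poly_fun n b \<and> (\<forall>C\<in>W. b C \<noteq> 0 \<and> (h \<circ> F) C = a C / b C)"
    proof (intro exI conjI ballI)
      show "openin ?Z {A \<in> principal_open n d. F A \<in> W}" by (rule pre[OF W(1)])
      show "A \<in> {A \<in> principal_open n d. F A \<in> W}" using A W(2) by simp
      show "{A \<in> principal_open n d. F A \<in> W} \<subseteq> {A \<in> principal_open n d. F A \<in> V}" using W(3) by auto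
      show "poly_fun n (\<lambda>A. a' A * d A ^ l)" "poly_fun n (\<lambda>A. b' A * d A ^ k)"
        using a'(1) b'(1) d by (simp_all add: poly_fun.mult poly_fun_power)
      fix C assume C: "C \<in> {A \<in> principal_open n d. F A \<in> W}"
      then have "d C \<noteq> 0" "b (F C) \<noteq> 0" "h (F C) = a (F C) / b (F C)"
        using W(6) by (auto simp: principal_open_def)
      then show "b' C * d C ^ k \<noteq> 0" "(h \<circ> F) C = a' C * d C ^ l / (b' C * d C ^ k)"
        using C a'(2) b'(2) by auto
    qed
  qed
qed

text \<open>
  The map need only be defined on an open neighbourhood \<open>W\<close> of the source: functions on a subspace are
  locally restrictions of ambient ones, which can be pulled back through \<open>W\<close>.
\<close>

lemma fs_morphism_subspaceI:
  assumes W: "openin (ztop Z) W" and X: "X \<subseteq> W"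
    and S: "\<phi> ` X \<subseteq> S" "S \<subseteq> topspace (ztop Y)"
    and cont: "\<And>V. openin (ztop Y) V \<Longrightarrow> openin (ztop Z) {x \<in> W. \<phi> x \<in> V}"
    and reg: "\<And>V f. openin (ztop Y) V \<Longrightarrow> regular Y V f \<Longrightarrow> regular Z {x \<in> W. \<phi> x \<in> V} (f \<circ> \<phi>)"
  shows "fs_morphism (fs_subspace Z X) (fs_subspace Y S) \<phi>"
proof -
  have XZ: "X \<subseteq> topspace (ztop Z)" using W X openin_subset by blast
  have pre: "openin (subtopology (ztop Z) X) {x \<in> topspace (subtopology (ztop Z) X). \<phi> x \<in> V}"
    if "openin (ztop Y) V" for V
  proof -
    have "{x \<in> topspace (subtopology (ztop Z) X). \<phi> x \<in> V} = {x \<in> W. \<phi> x \<in> V} \<inter> X"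
      using X XZ by auto
    then show ?thesis
      using cont[OF that] unfolding openin_subtopology by blast
  qed
  have "continuous_map (subtopology (ztop Z) X) (subtopology (ztop Y) S) \<phi>"
    unfolding continuous_map_in_subtopology
  proof
    show "continuous_map (subtopology (ztop Z) X) (ztop Y) \<phi>"
      unfolding continuous_map using S by (intro conjI allI impI pre) auto
  qed (use S in auto)
  moreover have "regular (fs_subspace Z X) {x \<in> topspace (ztop (fs_subspace Z X)). \<phi> x \<in> V} (f \<circ> \<phi>)"
    if "regular (fs_subspace Y S) V f" for V f
    unfolding regular_fs_subspace ztop_fs_subspace
  proof
    fix x assume "x \<in> {x \<in> topspace (subtopology (ztop Z) X). \<phi> x \<in> V}"
    then have x: "x \<in> W" "\<phi> x \<in> V" using X by auto
    from bspec[OF that[unfolded regular_fs_subspace] x(2)] obtain U g where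
      U: "openin (ztop Y) U" "\<phi> x \<in> U" "regular Y U g" "\<forall>y \<in> U \<inter> V. f y = g y"
      by (elim exE conjE)
    show "\<exists>U g. openin (ztop Z) U \<and> x \<in> U \<and> regular Z U g \<and>
        (\<forall>y \<in> U \<inter> {x \<in> topspace (subtopology (ztop Z) X). \<phi> x \<in> V}. (f \<circ> \<phi>) y = g y)"
      using cont[OF U(1)] reg[OF U(1,3)] x U(2,4)
      by (intro exI[of _ "{x \<in> W. \<phi> x \<in> U}"] exI[of _ "g \<circ> \<phi>"]) auto
  qed
  ultimately show ?thesis
    unfolding fs_morphism_def by (simp add: ztop_fs_subspace)
qed

section \<open>The homogeneous space\<close>

abbreviation coset :: "nat \<Rightarrow> nat \<Rightarrow> complex mat \<Rightarrow> complex mat set" where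
  "coset p q g \<equiv> g <#\<^bsub>GL (p + q)\<^esub> K_grp p q"

text \<open>
  The determinant takes the size of the matrix from its argument, while a polynomial function is one
  formula in the entries \<open>(i, j)\<close> with \<open>i, j < n\<close> for all matrices.
\<close>

definition det_fun :: "nat \<Rightarrow> complex mat \<Rightarrow> complex" where
  "det_fun n A = det (mat n n (\<lambda>(i, j). A $$ (i, j)))"

lemma det_fun_eq: "A \<in> carrier_mat n n \<Longrightarrow> det_fun n A = det A"
proof -
  assume "A \<in> carrier_mat n n"
  then have "mat n n (\<lambda>(i, j). A $$ (i, j)) = A" by auto
  then show ?thesis by (simp add: det_fun_def)
qed

lemma poly_det_fun: "poly_fun n (det_fun n)"
  using poly_fun_det[of n n "\<lambda>A i j. A $$ (i, j)"] poly_fun.entry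
  by (simp add: det_fun_def[abs_def])

lemma carrier_GL_principal_open: "carrier (GL n) = principal_open n (det_fun n)"
  by (auto simp: carrier_GL_iff principal_open_def det_fun_eq)

lemma openin_GL: "openin (ztop (matrix_space n)) (carrier (GL n))"
  unfolding carrier_GL_principal_open by (intro openin_principal_open poly_det_fun)

lemma topspace_GL_subspace:
  "topspace (ztop (fs_subspace (matrix_space n) (carrier (GL n)))) = carrier (GL n)"
  by (auto simp: fs_subspace_def topspace_matrix_space carrier_GL_iff)

lemma openin_GL_mod_K:
  "openin (ztop (GL_mod_K p q)) U \<longleftrightarrow> U \<subseteq> coset p q ` carrier (GL (p + q)) \<and>
     openin (ztop (matrix_space (p + q))) {g \<in> carrier (GL (p + q)). coset p q g \<in> U}"
proof -
  have "openin (ztop (fs_subspace (matrix_space (p + q)) (carrier (GL (p + q))))) V \<longleftrightarrow>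
      openin (ztop (matrix_space (p + q))) V" if "V \<subseteq> carrier (GL (p + q))" for V
    using that openin_open_subtopology[OF openin_GL] by (auto simp: fs_subspace_def)
  then show ?thesis
    unfolding GL_mod_K_def Let_def openin_fs_quotient topspace_GL_subspace by auto
qed

lemma regular_GL_mod_K:
  assumes "openin (ztop (GL_mod_K p q)) U"
  shows "regular (GL_mod_K p q) U f \<longleftrightarrow>
     regular (matrix_space (p + q)) {g \<in> carrier (GL (p + q)). coset p q g \<in> U} (f \<circ> coset p q)"
proof -
  have "regular (GL_mod_K p q) U f \<longleftrightarrow>
      regular (fs_subspace (matrix_space (p + q)) (carrier (GL (p + q))))
        {g \<in> carrier (GL (p + q)). coset p q g \<in> U} (f \<circ> coset p q)"
    unfolding GL_mod_K_def Let_def fs_quotient_def fun_space.simps topspace_GL_subspace ..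
  then show ?thesis
    using regular_open_subspace[OF conjunct2[OF assms[unfolded openin_GL_mod_K]]] by simp
qed

text \<open>
  Being constant on cosets, \<open>F\<close> descends to the open set of cosets of elements of \<open>W\<close>, where it is
  regular by the definition of the quotient structure, and there it inverts \<open>M \<mapsto> M K\<close> on \<open>S\<close>. The
  factor \<open>det_fun\<close> in the equation of \<open>W\<close> confines \<open>W\<close> to \<open>GL\<close>.
\<close>

lemma isomorphic_by_canonical_form:
  fixes p q d F S
  defines "W \<equiv> principal_open (p + q) (\<lambda>g. det_fun (p + q) g * d g)"
  assumes d: "poly_fun (p + q) d"
    and Fc: "\<And>g. g \<in> W \<Longrightarrow> F g \<in> carrier_mat (p + q) (p + q)"
    and F: "\<And>i j. i < p + q \<Longrightarrow> j < p + q \<Longrightarrow> rational_over (p + q) (\<lambda>g. det_fun (p + q) g * d g) (\<lambda>g. F g $$ (i, j))"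
    and inv: "\<And>g k. g \<in> W \<Longrightarrow> k \<in> K_grp p q \<Longrightarrow> g * k \<in> W \<and> F (g * k) = F g"
    and S: "S \<subseteq> W" "\<And>M. M \<in> S \<Longrightarrow> F M = M"
    and FS: "\<And>C. C \<in> X \<Longrightarrow> \<exists>g\<in>W. C = coset p q g \<and> F g \<in> S \<and> F g \<in> coset p q g"
    and SX: "\<And>M. M \<in> S \<Longrightarrow> coset p q M \<in> X"
  shows "fs_isomorphic (fs_subspace (GL_mod_K p q) X) (fs_subspace (matrix_space (p + q)) S)"
proof -
  let ?Z = "ztop (matrix_space (p + q))" and ?G = "carrier (GL (p + q))" and ?\<pi> = "coset p q"
  define \<Phi> where "\<Phi> C = F (SOME g. g \<in> C)" for C
  have dd: "poly_fun (p + q) (\<lambda>g. det_fun (p + q) g * d g)" by (intro poly_fun.mult poly_det_fun d)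
  have WG: "W \<subseteq> ?G" by (auto simp: W_def carrier_GL_principal_open principal_open_def)
  have oW: "openin ?Z W" unfolding W_def by (rule openin_principal_open[OF dd])
  have memW: "h \<in> W \<and> F h = F g" if "g \<in> W" "h \<in> ?\<pi> g" for g h
    using that inv unfolding coset_eq by blast
  have self: "g \<in> ?\<pi> g" if "g \<in> ?G" for g using coset_self that by simp
  have \<Phi>: "\<Phi> (?\<pi> g) = F g" if "g \<in> W" for g
    using memW[OF that] someI[of "\<lambda>h. h \<in> ?\<pi> g" g] self that WG unfolding \<Phi>_def by blast
  \<comment> \<open>\<open>W\<close> is a union of cosets, so the preimage of its image is \<open>W\<close> itself.\<close>
  have sat: "g \<in> W" if "g \<in> ?G" "?\<pi> g \<in> ?\<pi> ` W" for g
    using self[OF that(1)] that(2) memW by auto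
  have pre: "{g \<in> ?G. ?\<pi> g \<in> {C \<in> ?\<pi> ` W. \<Phi> C \<in> V}} = {g \<in> W. F g \<in> V}" for V
    using sat WG \<Phi> by (auto simp del: imageE) (metis \<Phi> imageI sat)+
  have oPW: "openin (ztop (GL_mod_K p q)) {C \<in> ?\<pi> ` W. \<Phi> C \<in> V}" if "openin ?Z V" for V
    unfolding openin_GL_mod_K
  proof
    show "{C \<in> ?\<pi> ` W. \<Phi> C \<in> V} \<subseteq> ?\<pi> ` carrier (GL (p + q))" using WG by auto
    show "openin (ztop (matrix_space (p + q)))
        {g \<in> carrier (GL (p + q)). ?\<pi> g \<in> {C \<in> ?\<pi> ` W. \<Phi> C \<in> V}}"
      unfolding pre unfolding W_def
      by (rule openin_rational_preimage[OF dd Fc F that]) (simp_all add: W_def)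
  qed
  have "fs_morphism (fs_subspace (GL_mod_K p q) X) (fs_subspace (matrix_space (p + q)) S) \<Phi>"
  proof (rule fs_morphism_subspaceI[where W = "?\<pi> ` W"])
    have "{C \<in> ?\<pi> ` W. \<Phi> C \<in> topspace ?Z} = ?\<pi> ` W"
      using \<Phi> Fc by (auto simp: topspace_matrix_space)
    then show "openin (ztop (GL_mod_K p q)) (?\<pi> ` W)"
      using oPW[OF openin_topspace] by simp
    show "X \<subseteq> ?\<pi> ` W" using FS by blast
    show "\<Phi> ` X \<subseteq> S" using FS \<Phi> by fastforce
    show "S \<subseteq> topspace ?Z" using S WG by (auto simp: topspace_matrix_space carrier_GL_iff)
    fix V assume V: "openin ?Z V"
    show o: "openin (ztop (GL_mod_K p q)) {C \<in> ?\<pi> ` W. \<Phi> C \<in> V}" by (rule oPW[OF V])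
    fix f assume f: "regular (matrix_space (p + q)) V f"
    have "regular (matrix_space (p + q)) {g \<in> W. F g \<in> V} (f \<circ> F)"
      unfolding W_def by (rule regular_rational_pullback[OF dd Fc F V f]) (simp_all add: W_def)
    moreover have "openin ?Z {g \<in> W. F g \<in> V}"
      using conjunct2[OF o[unfolded openin_GL_mod_K]] unfolding pre .
    ultimately have "regular (matrix_space (p + q)) {g \<in> W. F g \<in> V} (f \<circ> \<Phi> \<circ> ?\<pi>)"
      by (rule regular_matrix_space_subset) (simp_all add: \<Phi>)
    then show "regular (GL_mod_K p q) {C \<in> ?\<pi> ` W. \<Phi> C \<in> V} (f \<circ> \<Phi>)"
      unfolding regular_GL_mod_K[OF o] unfolding pre .
  qed
  moreover have "fs_morphism (fs_subspace (matrix_space (p + q)) S) (fs_subspace (GL_mod_K p q) X) ?\<pi>"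
  proof (rule fs_morphism_subspaceI[where W = ?G])
    show "openin ?Z ?G" by (rule openin_GL)
    show "S \<subseteq> ?G" using S WG by blast
    show "?\<pi> ` S \<subseteq> X" using SX by blast
    show "X \<subseteq> topspace (ztop (GL_mod_K p q))"
      using FS WG unfolding topspace_GL_mod_K LCOSETS_def by fastforce
    fix V assume V: "openin (ztop (GL_mod_K p q)) V"
    then show "openin ?Z {g \<in> ?G. ?\<pi> g \<in> V}" by (simp add: openin_GL_mod_K)
    fix f assume "regular (GL_mod_K p q) V f"
    then show "regular (matrix_space (p + q)) {g \<in> ?G. ?\<pi> g \<in> V} (f \<circ> ?\<pi>)"
      using regular_GL_mod_K[OF V] by simp
  qed
  moreover have "?\<pi> (\<Phi> C) = C" if C: "C \<in> X" for C
  proof -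
    obtain g where g: "g \<in> W" "C = ?\<pi> g" "F g \<in> ?\<pi> g" using FS[OF C] by blast
    then obtain k where "k \<in> K_grp p q" "F g = g * k" unfolding coset_eq by blast
    then show ?thesis using g \<Phi> coset_mult_K WG by auto
  qed
  moreover have "\<Phi> (?\<pi> M) = M" if "M \<in> S" for M
    using \<Phi> S that by auto
  ultimately show ?thesis
    unfolding fs_isomorphic_def by (intro exI[of _ \<Phi>] exI[of _ ?\<pi>]) (auto simp: fs_subspace_def)
qed

section \<open>Lower triangular unipotent matrices\<close>

lemma U_minus_GL: "u \<in> U_minus n \<Longrightarrow> u \<in> carrier (GL n)"
proof -
  assume u: "u \<in> U_minus n"
  then have uc: "u \<in> carrier_mat n n" by (simp add: U_minus_def)
  have "det u = prod_list (diag_mat u)"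
    by (rule det_lower_triangular[OF _ uc]) (use u in \<open>auto simp: U_minus_def\<close>)
  also have "diag_mat u = map (\<lambda>_. 1) [0..<n]"
    using u uc by (auto simp: diag_mat_def U_minus_def)
  finally have "det u = 1" by (simp add: map_replicate_const)
  then show ?thesis using uc by (simp add: carrier_GL_iff)
qed

lemma U_minus_mult:
  assumes "u \<in> U_minus n" "v \<in> U_minus n"
  shows "u * v \<in> U_minus n"
proof -
  have c: "u \<in> carrier_mat n n" "v \<in> carrier_mat n n" using assms by (auto simp: U_minus_def)
  have "(u * v) $$ (i, j) = (if i = j then 1 else 0)" if ij: "i < n" "j < n" "i \<le> j" for i j
  proof -
    have "(u * v) $$ (i, j) = (\<Sum>k<n. u $$ (i, k) * v $$ (k, j))"
      by (rule mult_entry[OF c ij(1,2)])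
    also have "\<dots> = (\<Sum>k<n. if k = i then if i = j then 1 else 0 else 0)"
    proof (rule sum.cong)
      fix k assume k: "k \<in> {..<n}"
      consider "i < k" | "k < i" "k < j" | "k = i" "i < j" | "k = i" "i = j" using ij by linarith
      then show "u $$ (i, k) * v $$ (k, j) = (if k = i then if i = j then 1 else 0 else 0)"
        using assms ij k by cases (auto simp: U_minus_def)
    qed simp
    also have "\<dots> = (if i = j then 1 else 0)" using ij by simp
    finally show ?thesis .
  qed
  then show ?thesis using c by (simp add: U_minus_def)
qed

text \<open>Forward substitution: the row \<open>r\<close> of \<open>u v = 1\<close> determines the row \<open>r\<close> of \<open>v\<close> from the earlier ones.\<close>

lemma U_minus_inverse:
  assumes u: "u \<in> U_minus n" and v: "v \<in> carrier_mat n n" "u * v = 1\<^sub>m n"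
  shows "v \<in> U_minus n"
proof -
  have c: "u \<in> carrier_mat n n" using u by (simp add: U_minus_def)
  have "r \<le> j \<longrightarrow> v $$ (r, j) = (if r = j then 1 else 0)" if "r < n" and j: "j < n" for r j
    using that(1)
  proof (induction r rule: less_induct)
    case (less r)
    show ?case
    proof
      assume rj: "r \<le> j"
      have "(\<Sum>k<n. u $$ (r, k) * v $$ (k, j)) = (u * v) $$ (r, j)"
        by (rule mult_entry[symmetric, OF c v(1) less.prems j])
      also have "\<dots> = (if r = j then 1 else 0)" using v(2) less.prems j by simp
      also have "(\<Sum>k<n. u $$ (r, k) * v $$ (k, j)) = (\<Sum>k<n. if k = r then v $$ (r, j) else 0)"
      proof (rule sum.cong)
        fix k assume k: "k \<in> {..<n}"
        consider "r < k" | "k < r" | "k = r" by linarith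
        then show "u $$ (r, k) * v $$ (k, j) = (if k = r then v $$ (r, j) else 0)"
          using u less k rj j by cases (auto simp: U_minus_def)
      qed simp
      also have "\<dots> = v $$ (r, j)" using less.prems by simp
      finally show "v $$ (r, j) = (if r = j then 1 else 0)" .
    qed
  qed
  then show ?thesis using v(1) by (simp add: U_minus_def)
qed

lemma cancel_involution:
  fixes A B :: "complex mat"
  assumes "A * A = 1\<^sub>m n" "A \<in> carrier_mat n n" "B \<in> carrier_mat n n"
  shows "A * (A * B) = B"
  using mult_assoc_square[OF assms(2,2,3)] left_mult_one_mat[OF assms(3)] assms(1) by simp

section \<open>Combinatorics of a clan\<close>

lemma rank_less_iff:
  fixes A :: "nat set"
  assumes "finite A" "i \<in> A" "j \<in> A"
  shows "card {k \<in> A. k < i} < card {k \<in> A. k < j} \<longleftrightarrow> i < j"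
proof -
  have mono: "card {k \<in> A. k < i} < card {k \<in> A. k < j}" if "i < j" "i \<in> A" for i j
    by (rule psubset_card_mono) (use assms(1) that in auto)
  show ?thesis
    using mono[of i j] mono[of j i] assms by (cases i j rule: linorder_cases) auto
qed

lemma rank_less_card:
  fixes A :: "nat set"
  assumes "finite A" "i \<in> A"
  shows "card {k \<in> A. k < i} < card A"
  by (rule psubset_card_mono) (use assms in auto)

locale clan_setup =
  fixes p q :: nat and \<alpha> :: clan
  assumes clan: "\<alpha> \<in> clans p q"
begin

abbreviation "n \<equiv> p + q"
abbreviation "P \<equiv> pluses \<alpha>"
abbreviation "N \<equiv> minuses \<alpha>"
abbreviation "L \<equiv> lefts \<alpha>"
abbreviation "w \<equiv> w_clan p \<alpha>"
abbreviation "x \<equiv> x_clan p q \<alpha>"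

definition R :: "nat set" where "R = snd ` matchings \<alpha>"

text \<open>Unmatched vertices are fixed points, so that \<open>partner\<close> is an involution.\<close>

definition partner :: "nat \<Rightarrow> nat" where
  "partner i =
     (if i \<in> L then THE j. (i, j) \<in> matchings \<alpha>
      else if i \<in> R then THE j. (j, i) \<in> matchings \<alpha> else i)"

lemma matching_less: "(i, j) \<in> matchings \<alpha> \<Longrightarrow> i < j \<and> j < n"
  using clan by (auto simp: clans_def)

lemma matching_unique:
  assumes "(i, j) \<in> matchings \<alpha>" "(i', j') \<in> matchings \<alpha>" "i = i' \<or> i = j' \<or> j = i' \<or> j = j'"
  shows "i = i' \<and> j = j'"
proof -
  have "\<forall>m\<in>matchings \<alpha>. \<forall>m'\<in>matchings \<alpha>. m \<noteq> m' \<longrightarrow> {fst m, snd m} \<inter> {fst m', snd m'} = {}"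
    using clan by (simp add: clans_def)
  from bspec[OF bspec[OF this assms(1)] assms(2)] show ?thesis
    using assms(3) by auto
qed

lemma left_right_disjoint: "i \<in> L \<Longrightarrow> i \<notin> R"
proof
  assume "i \<in> L" "i \<in> R"
  then obtain j k where "(i, j) \<in> matchings \<alpha>" "(k, i) \<in> matchings \<alpha>"
    by (auto simp: lefts_def R_def)
  then show False using matching_unique[of i j k i] matching_less by auto
qed

lemma partner_matching:
  assumes "(i, j) \<in> matchings \<alpha>"
  shows "partner i = j" "partner j = i" "i \<in> L" "j \<in> R" "i \<notin> R" "j \<notin> L"
proof -
  show LR: "i \<in> L" "j \<in> R" using assms by (force simp: lefts_def R_def)+
  then show "i \<notin> R" "j \<notin> L" using left_right_disjoint by blast+
  have "(THE j. (i, j) \<in> matchings \<alpha>) = j"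
    using assms matching_unique by (intro the_equality) blast+
  then show "partner i = j" using LR by (simp add: partner_def)
  have "(THE i. (i, j) \<in> matchings \<alpha>) = i"
    using assms matching_unique by (intro the_equality) blast+
  then show "partner j = i" using LR \<open>j \<notin> L\<close> by (simp add: partner_def)
qed

lemma left_matching: "i \<in> L \<Longrightarrow> (i, partner i) \<in> matchings \<alpha>"
  using partner_matching(1) unfolding lefts_def by force

lemma right_matching: "i \<in> R \<Longrightarrow> (partner i, i) \<in> matchings \<alpha>"
  using partner_matching(2) unfolding R_def by force

lemma left_facts: "i \<in> L \<Longrightarrow> partner i \<in> R" "i \<in> L \<Longrightarrow> partner i \<notin> L" "i \<in> L \<Longrightarrow> i < partner i"
    "i \<in> L \<Longrightarrow> i < n"
  using left_matching[of i] matching_less[of i "partner i"] partner_matching[of i "partner i"] by auto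

lemma right_facts: "i \<in> R \<Longrightarrow> partner i \<in> L" "i \<in> R \<Longrightarrow> partner i \<notin> R" "i \<in> R \<Longrightarrow> partner i < i"
    "i \<in> R \<Longrightarrow> i < n"
  using right_matching[of i] matching_less[of "partner i" i] partner_matching[of "partner i" i] by auto

lemma partner_partner [simp]: "partner (partner i) = i"
proof (cases "i \<in> L")
  case True
  from partner_matching(2)[OF left_matching[OF this]] show ?thesis .
next
  case False
  show ?thesis
  proof (cases "i \<in> R")
    case True
    from partner_matching(1)[OF right_matching[OF this]] show ?thesis .
  qed (use False in \<open>simp add: partner_def\<close>)
qed

lemma signed_iff: "i \<in> P \<or> i \<in> N \<longleftrightarrow> i < n \<and> i \<notin> L \<and> i \<notin> R"
proof -
  have "P \<union> N = {..<n} - (\<Union>m\<in>matchings \<alpha>. {fst m, snd m})" using clan by (simp add: clans_def)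
  moreover have "(\<Union>m\<in>matchings \<alpha>. {fst m, snd m}) = L \<union> R" by (auto simp: lefts_def R_def)
  ultimately show ?thesis by blast
qed

lemma plus_minus_disjoint: "i \<in> P \<Longrightarrow> i \<notin> N"
  using clan by (auto simp: clans_def)

lemma signed_partner: "i \<in> P \<Longrightarrow> partner i = i" "i \<in> N \<Longrightarrow> partner i = i"
  using signed_iff[of i] by (auto simp: partner_def)

lemma vertex_cases [case_names plus minus left right]:
  assumes "i < n"
  obtains "i \<in> P" "i \<notin> N" "i \<notin> L" "i \<notin> R" "partner i = i"
  | "i \<in> N" "i \<notin> P" "i \<notin> L" "i \<notin> R" "partner i = i"
  | "i \<in> L" "i \<notin> P" "i \<notin> N" "i \<notin> R" "partner i \<in> R" "partner i \<notin> L" "partner i \<notin> P"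
      "partner i \<notin> N" "i < partner i" "partner i < n"
  | "i \<in> R" "i \<notin> P" "i \<notin> N" "i \<notin> L" "partner i \<in> L" "partner i \<notin> R" "partner i \<notin> P"
      "partner i \<notin> N" "partner i < i" "partner i < n"
proof -
  consider "i \<in> L" | "i \<in> R" | "i \<in> P" | "i \<in> N" using signed_iff assms by blast
  then show ?thesis
  proof cases
    case 1
    show ?thesis
      by (rule that(3)) (use 1 left_facts[of i] right_facts(4)[of "partner i"] signed_iff[of i]
          signed_iff[of "partner i"] left_right_disjoint in auto)
  next
    case 2
    show ?thesis
      by (rule that(4)) (use 2 right_facts[of i] left_facts(4)[of "partner i"] signed_iff[of i]
          signed_iff[of "partner i"] left_right_disjoint in auto)
  next
    case 3
    show ?thesis
      by (rule that(1)) (use 3 signed_iff[of i] plus_minus_disjoint signed_partner in auto)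
  next
    case 4
    show ?thesis
      by (rule that(2)) (use 4 signed_iff[of i] plus_minus_disjoint signed_partner in auto)
  qed
qed

lemma partner_less:
  assumes "i < n" shows "partner i < n"
  by (cases rule: vertex_cases[OF assms]) (use assms in auto)

lemma vertex_less: "i \<in> P \<Longrightarrow> i < n" "i \<in> N \<Longrightarrow> i < n"
  using signed_iff by blast+

lemma vertex_disjoint:
  "i \<in> P \<Longrightarrow> i \<notin> N \<and> i \<notin> L \<and> i \<notin> R" "i \<in> N \<Longrightarrow> i \<notin> P \<and> i \<notin> L \<and> i \<notin> R"
  "i \<in> L \<Longrightarrow> i \<notin> P \<and> i \<notin> N \<and> i \<notin> R" "i \<in> R \<Longrightarrow> i \<notin> P \<and> i \<notin> N \<and> i \<notin> L"
  using signed_iff[of i] left_right_disjoint[of i] plus_minus_disjoint[of i] by blast+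

lemma vertex_class_less: "i \<in> P \<union> L \<Longrightarrow> i < n" "i \<in> N \<union> R \<Longrightarrow> i < n" "i \<in> P \<union> R \<Longrightarrow> i < n"
  using vertex_less[of i] left_facts(4)[of i] right_facts(4)[of i] by blast+

lemma ex_matching_left: "(\<exists>j. (r, j) \<in> matchings \<alpha> \<and> Q j) \<longleftrightarrow> r \<in> L \<and> Q (partner r)"
  using left_matching partner_matching by blast

lemma ex_matching_right: "(\<exists>j. (j, r) \<in> matchings \<alpha> \<and> Q j) \<longleftrightarrow> r \<in> R \<and> Q (partner r)"
  using right_matching partner_matching by blast

lemma finite_vertices: "finite P" "finite N" "finite L" "finite R"
proof -
  have "P \<subseteq> {..<n}" "N \<subseteq> {..<n}" "L \<subseteq> {..<n}" "R \<subseteq> {..<n}"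
    using vertex_less left_facts(4) right_facts(4) by auto
  then show "finite P" "finite N" "finite L" "finite R"
    using finite_subset finite_lessThan by blast+
qed

text \<open>
  Counting vertices gives \<open>card P + card N + 2 * card L = p + q\<close>, and
  \<open>card P - card N = p - q\<close> by the definition of clans.
\<close>

lemma card_first_last: "card (P \<union> L) = p" "card (N \<union> L) = q"
proof -
  have "partner ` L = R"
  proof (intro subset_antisym subsetI)
    fix j assume "j \<in> R"
    then show "j \<in> partner ` L"
      using right_facts(1)[of j] by (intro image_eqI[of _ _ "partner j"]) auto
  qed (auto simp: left_facts)
  moreover have "inj_on partner L" by (metis inj_onI partner_partner)
  ultimately have LR: "card L = card R" using card_image by fastforce
  have "{..<n} = (P \<union> L) \<union> (N \<union> R)"
    using signed_iff left_facts(4) right_facts(4) by blast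
  moreover have d: "(P \<union> L) \<inter> (N \<union> R) = {}" "P \<inter> L = {}" "N \<inter> R = {}" "N \<inter> L = {}"
    using signed_iff left_right_disjoint plus_minus_disjoint by blast+
  ultimately have "n = card (P \<union> L) + card (N \<union> R)"
    using card_Un_disjoint[of "P \<union> L" "N \<union> R"] finite_vertices card_lessThan[of n] by simp
  then have "n = card P + card L + (card N + card L)"
    using d finite_vertices by (simp add: card_Un_disjoint LR)
  moreover have "int (card P) - int (card N) = int p - int q" using clan by (simp add: clans_def)
  ultimately have "card P + card L = p" "card N + card L = q" by linarith+
  then show "card (P \<union> L) = p" "card (N \<union> L) = q"
    using d finite_vertices by (simp_all add: card_Un_disjoint)
qed

text \<open>
  Columns are named by the vertices \<open>i\<close> through \<open>w i\<close>. The column of a right end has two ones, and the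
  northern one is in the row of the left end.
\<close>

definition pivot_row :: "nat \<Rightarrow> nat" where
  "pivot_row i = (if i \<in> R then partner i else i)"

lemma w_first: "i \<in> P \<union> L \<Longrightarrow> w i = card {k \<in> P \<union> L. k < i}"
  by (simp add: w_clan_def)

lemma w_last: 
  assumes "i \<in> N \<union> R"
  shows "w i = p + card {k \<in> N \<union> L. k < pivot_row i}"
proof -
  have "i < n" using assms vertex_less right_facts by blast
  then show ?thesis
  proof (cases rule: vertex_cases)
    case right
    have "(THE l. (l, i) \<in> matchings \<alpha>) = partner i"
      using right by (simp add: partner_def)
    then show ?thesis using right by (simp add: w_clan_def pivot_row_def)
  qed (use assms in \<open>auto simp: w_clan_def pivot_row_def\<close>)
qed

lemma pivot_row_last: "i \<in> N \<union> R \<Longrightarrow> pivot_row i \<in> N \<union> L"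
  using right_facts(1) by (auto simp: pivot_row_def)

lemma w_bounds: "i \<in> P \<union> L \<Longrightarrow> w i < p" "i \<in> N \<union> R \<Longrightarrow> p \<le> w i \<and> w i < n"
  using rank_less_card[of "P \<union> L" i] rank_less_card[of "N \<union> L" "pivot_row i"]
  by (auto simp: w_first w_last finite_vertices card_first_last pivot_row_last[simplified])

lemma w_less_p_iff:
  assumes "i < n" shows "w i < p \<longleftrightarrow> i \<in> P \<union> L"
  using w_bounds[of i] by (cases rule: vertex_cases[OF assms]) auto

lemma w_less:
  assumes "i < n" shows "w i < n"
  using w_bounds[of i] by (cases rule: vertex_cases[OF assms]) auto

lemma w_first_mono: "i \<in> P \<union> L \<Longrightarrow> j \<in> P \<union> L \<Longrightarrow> w i < w j \<longleftrightarrow> i < j"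
  using rank_less_iff[of "P \<union> L" i j] by (simp only: w_first) (simp add: finite_vertices)

lemma w_last_mono: "i \<in> N \<union> R \<Longrightarrow> j \<in> N \<union> R \<Longrightarrow> w i < w j \<longleftrightarrow> pivot_row i < pivot_row j"
  using rank_less_iff[of "N \<union> L" "pivot_row i" "pivot_row j"] pivot_row_last[of i] pivot_row_last[of j]
  by (simp only: w_last) (simp add: finite_vertices)

lemma pivot_row_inj:
  assumes "i \<in> N \<union> R" "j \<in> N \<union> R" "pivot_row i = pivot_row j"
  shows "i = j"
proof -
  have "(if pivot_row i \<in> L then partner (pivot_row i) else pivot_row i) = i" if "i \<in> N \<union> R" for i
    using that right_facts(1)[of i] signed_iff[of i] by (auto simp: pivot_row_def)
  from this[OF assms(1)] this[OF assms(2)] show ?thesis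
    unfolding assms(3) by (rule trans[OF sym])
qed

lemma w_eq_iff [simp]: 
  assumes "i < n" "j < n"
  shows "w i = w j \<longleftrightarrow> i = j"
proof
  assume e: "w i = w j"
  have "i \<in> P \<union> L \<or> i \<in> N \<union> R" "j \<in> P \<union> L \<or> j \<in> N \<union> R"
    using assms signed_iff by blast+
  then consider "i \<in> P \<union> L" "j \<in> P \<union> L" | "i \<in> N \<union> R" "j \<in> N \<union> R"
    using w_bounds[of i] w_bounds[of j] e by fastforce
  then show "i = j"
  proof cases
    case 1
    then show ?thesis using w_first_mono[of i j] w_first_mono[of j i] e by simp
  next
    case 2
    then have "pivot_row i = pivot_row j" using w_last_mono[of i j] w_last_mono[of j i] e by simp
    then show ?thesis using 2 pivot_row_inj by blast
  qed
qed simp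

lemma w_surj:
  assumes "c < n" shows "\<exists>i<n. w i = c"
proof -
  have "w ` {..<n} = {..<n}"
    by (rule endo_inj_surj) (auto simp: w_less inj_on_def)
  then have "c \<in> w ` {..<n}" using assms by simp
  then show ?thesis by auto
qed

lemma has_one_iff: "i < n \<Longrightarrow> has_one p \<alpha> r (w i) \<longleftrightarrow> r = i \<or> (i \<in> R \<and> r = partner i)"
proof -
  assume i: "i < n"
  show ?thesis
  proof (cases "r < n")
    case True
    then show ?thesis
      unfolding has_one_def ex_matching_left ex_matching_right using i partner_partner[of r]
      by (cases rule: vertex_cases[OF True]) auto
  next
    case False
    then have "r \<notin> P" "r \<notin> N" "r \<notin> L" "r \<notin> R"
      using vertex_less left_facts(4) right_facts(4) by blast+
    then show ?thesis
      unfolding has_one_def ex_matching_left ex_matching_right using False i partner_less[of i] by auto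
  qed
qed

lemma has_minus_one_iff: "i < n \<Longrightarrow> has_minus_one p \<alpha> r (w i) \<longleftrightarrow> i \<in> L \<and> r = partner i"
  unfolding has_minus_one_def ex_matching_right
  using right_facts[of r] left_facts[of i] partner_less[of r] partner_partner[of r] partner_partner[of i]
  by (metis w_eq_iff)

lemma pivot_eq: "i < n \<Longrightarrow> pivot p \<alpha> (w i) = pivot_row i"
  unfolding pivot_def
proof (rule Least_equality)
  assume i: "i < n"
  show "has_one p \<alpha> (pivot_row i) (w i)" using i by (auto simp: has_one_iff pivot_row_def)
  fix r assume "has_one p \<alpha> r (w i)"
  then show "pivot_row i \<le> r"
    using i right_facts(3)[of i] by (auto simp: has_one_iff pivot_row_def)
qed

text \<open>
  A position lies weakly below the diagonal together with its image under the involution. These are the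
  positions where matrices in \<open>U\<^sup>- \<inter> \<psi>(U\<^sup>-)\<close> may be nonzero.
\<close>

definition dominates :: "nat \<Rightarrow> nat \<Rightarrow> bool" where
  "dominates r c \<longleftrightarrow> c \<le> r \<and> partner c \<le> partner r"

text \<open>
  Outside the rows of pivots, the zero conditions on a column in the first block combine into one: the
  column of a left end behaves as if it began at the right end, and a right end \<open>r\<close> excludes from its row
  the columns of the vertices after \<open>partner r\<close>.
\<close>

lemma zero_first_iff:
  assumes i: "i \<in> P \<union> L" and r: "r \<in> N \<union> R" "r \<noteq> partner i"
  shows "zero_first p q \<alpha> r (w i) \<longleftrightarrow> \<not> dominates r (partner i)"
proof -
  have bnd: "i < n" "r < n" using vertex_class_less i r by simp_all
  have ir: "i \<noteq> r" using i r vertex_disjoint[of i] by blast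
  have no_pivot: "\<not> (\<exists>d<p. pivot p \<alpha> d = r)"
  proof
    assume "\<exists>d<p. pivot p \<alpha> d = r"
    then obtain d where d: "d < p" "pivot p \<alpha> d = r" by blast
    obtain j where j: "j < n" "w j = d" using w_surj[of d] d by auto
    then have "j \<in> P \<union> L" using d w_less_p_iff[of j] by simp
    moreover have "pivot_row j = r" using d(2) j(2) pivot_eq[OF j(1)] by simp
    ultimately have "r \<in> P \<union> L"
      using vertex_disjoint(1,3)[of j] by (auto simp: pivot_row_def)
    then show False using r(1) vertex_disjoint(1,3)[of r] by blast
  qed
  have right: "(\<exists>d<w i. has_minus_one p \<alpha> r d) \<longleftrightarrow> r \<in> R \<and> partner r < i"
  proof
    assume "\<exists>d<w i. has_minus_one p \<alpha> r d"
    then obtain d where d: "d < w i" "has_minus_one p \<alpha> r d" by blast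
    obtain j where j: "j < n" "w j = d" using w_surj[of d] d w_less[of i] bnd by force
    then have "j \<in> L" "r = partner j" using d has_minus_one_iff by auto
    then show "r \<in> R \<and> partner r < i" using d(1) j(2) w_first_mono[of j i] i left_facts(1)[of j] by auto
  next
    assume a: "r \<in> R \<and> partner r < i"
    then have "partner r \<in> L" by (simp add: right_facts)
    then have "w (partner r) < w i" "has_minus_one p \<alpha> r (w (partner r))"
      using a i w_first_mono[of "partner r" i] by (auto simp: has_minus_one_iff left_facts)
    then show "\<exists>d<w i. has_minus_one p \<alpha> r d" by blast
  qed
  have piv: "pivot p \<alpha> (w i) = i"
    using bnd i vertex_disjoint(1,3)[of i] by (auto simp: pivot_eq pivot_row_def)
  have between: "(\<exists>s. has_minus_one p \<alpha> s (w i) \<and> i < r \<and> r < s) \<longleftrightarrow> i \<in> L \<and> i < r \<and> r < partner i"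
    unfolding has_minus_one_iff[OF bnd(1)] by simp
  have "zero_first p q \<alpha> r (w i) \<longleftrightarrow>
      r < i \<or> (i \<in> L \<and> i < r \<and> r < partner i) \<or> (r \<in> R \<and> partner r < i)"
    using no_pivot w_bounds(1)[OF i]
    by (simp only: zero_first_def piv between right simp_thms)
  also have "\<dots> \<longleftrightarrow> \<not> dominates r (partner i)"
    using i r ir unfolding dominates_def
    by (cases rule: vertex_cases[OF bnd(1)]; cases rule: vertex_cases[OF bnd(2)]) auto
  finally show ?thesis .
qed

text \<open>
  In the last block the column of a matching is that of its right end, but it is the left ends that
  determine the order of these columns.
\<close>

lemma zero_last_iff:
  assumes i: "i \<in> N \<union> R" and r: "r \<in> P \<union> R" "r \<noteq> i"
  shows "zero_last p q \<alpha> r (w i) \<longleftrightarrow> \<not> dominates r i"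
proof -
  have bnd: "i < n" "r < n" using vertex_class_less i r by simp_all
  have NL: "r \<notin> N" "r \<notin> L" using r vertex_disjoint[of r] by blast+
  have pr: "pivot_row i \<noteq> r" using pivot_row_last[OF i] NL by blast
  have no_pivot: "\<not> (\<exists>d\<in>{p..<p + q}. pivot p \<alpha> d = r)"
  proof
    assume "\<exists>d\<in>{p..<p + q}. pivot p \<alpha> d = r"
    then obtain d where d: "p \<le> d" "d < n" "pivot p \<alpha> d = r" by auto
    obtain j where j: "j < n" "w j = d" using w_surj[of d] d by auto
    then have "j \<in> N \<union> R" using d w_less_p_iff[of j] signed_iff[of j] by auto
    then have "pivot_row j \<in> N \<union> L" by (rule pivot_row_last)
    moreover have "pivot_row j = r" using d(3) j(2) pivot_eq[OF j(1)] by simp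
    ultimately show False using NL by blast
  qed
  have right: "(\<exists>d\<in>{p..<w i}. has_one p \<alpha> r d \<and> pivot p \<alpha> d < r) \<longleftrightarrow> r \<in> R \<and> partner r < pivot_row i"
  proof
    assume "\<exists>d\<in>{p..<w i}. has_one p \<alpha> r d \<and> pivot p \<alpha> d < r"
    then obtain d where d: "p \<le> d" "d < w i" "has_one p \<alpha> r d" "pivot p \<alpha> d < r" by auto
    obtain j where j: "j < n" "w j = d" using w_surj[of d] d w_less[of i] bnd by force
    then have jl: "j \<in> N \<union> R" using d w_less_p_iff[of j] signed_iff[of j] by auto
    have pj: "pivot_row j < r" using d(4) pivot_eq[OF j(1)] j(2) by simp
    have "r = j \<or> (j \<in> R \<and> r = partner j)" using d(3) has_one_iff[OF j(1)] j(2) by simp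
    then have "j = r" using pj by (auto simp: pivot_row_def)
    then have "r \<in> R" using pj by (auto simp: pivot_row_def split: if_splits)
    moreover have "pivot_row j < pivot_row i" using d(2) j(2) w_last_mono[OF jl i] by simp
    ultimately show "r \<in> R \<and> partner r < pivot_row i"
      using \<open>j = r\<close> by (simp add: pivot_row_def)
  next
    assume a: "r \<in> R \<and> partner r < pivot_row i"
    then have rl: "r \<in> N \<union> R" and pr: "pivot_row r = partner r" by (simp_all add: pivot_row_def)
    have "w r < w i" using w_last_mono[OF rl i] a pr by simp
    moreover have "p \<le> w r" using w_bounds(2)[OF rl] by simp
    moreover have "has_one p \<alpha> r (w r)" using has_one_iff[OF bnd(2)] by simp
    moreover have "pivot p \<alpha> (w r) < r" using pivot_eq[OF bnd(2)] pr a right_facts(3)[of r] by simp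
    ultimately show "\<exists>d\<in>{p..<w i}. has_one p \<alpha> r d \<and> pivot p \<alpha> d < r" by auto
  qed
  have between: "(\<exists>s. has_one p \<alpha> s (w i) \<and> pivot_row i < r \<and> r < s) \<longleftrightarrow> pivot_row i < r \<and> r < i"
    unfolding has_one_iff[OF bnd(1)] using right_facts(3)[of i] by auto
  have "zero_last p q \<alpha> r (w i) \<longleftrightarrow>
      r < pivot_row i \<or> (pivot_row i < r \<and> r < i) \<or> (r \<in> R \<and> partner r < pivot_row i)"
    using no_pivot w_bounds(2)[OF i]
    by (simp only: zero_last_def pivot_eq[OF bnd(1)] between right simp_thms)
  also have "\<dots> \<longleftrightarrow> \<not> dominates r i"
    using i r pr unfolding dominates_def
    by (cases rule: vertex_cases[OF bnd(1)]; cases rule: vertex_cases[OF bnd(2)]) (auto simp: pivot_row_def)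
  finally show ?thesis .
qed

text \<open>
  The matchings with right ends \<open>k\<close> and \<open>r\<close> cross, the one of \<open>k\<close> beginning first. Then the entry in
  row \<open>r\<close> and the column of \<open>k\<close> is tied to another one.
\<close>

definition crossing :: "nat \<Rightarrow> nat \<Rightarrow> bool" where
  "crossing r k \<longleftrightarrow> k \<in> R \<and> r \<in> R \<and> partner k < partner r \<and> partner r < k \<and> k < r"

lemma dependent_iff:
  assumes "k < n"
  shows "dependent p \<alpha> r (w k) i \<longleftrightarrow> crossing r k \<and> i = partner k"
proof
  assume "dependent p \<alpha> r (w k) i"
  then obtain j k' where "(i, k') \<in> matchings \<alpha>" "(j, r) \<in> matchings \<alpha>" "i < j" "j < k'" "k' < r"
    "w k = w k'" unfolding dependent_def by blast
  moreover from this have "k = k'" using assms matching_less by (metis w_eq_iff)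
  ultimately show "crossing r k \<and> i = partner k"
    unfolding crossing_def using partner_matching[of i k'] partner_matching[of j r] by simp
next
  assume a: "crossing r k \<and> i = partner k"
  then show "dependent p \<alpha> r (w k) i"
    unfolding dependent_def crossing_def
    using right_matching[of k] right_matching[of r]
    by (intro exI[of _ "partner r"] exI[of _ k]) auto
qed

lemma generic_entry_raw:
  assumes r: "r < n" and i: "i < n"
  shows "generic_matrix p q \<alpha> z $$ (r, w i) =
    (if r = i \<or> (i \<in> R \<and> r = partner i) then 1
     else if i \<in> L \<and> r = partner i then - 1
     else if zero_first p q \<alpha> r (w i) \<or> zero_last p q \<alpha> r (w i) then 0
     else if crossing r i then - z r (w (partner i)) else z r (w i))"
proof -
  have "dependent p \<alpha> r (w i) = (\<lambda>j. crossing r i \<and> j = partner i)"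
    using dependent_iff[OF i] by blast
  then show ?thesis
    using assms w_less[OF i]
    by (cases "crossing r i") (simp_all add: generic_matrix_def has_one_iff has_minus_one_iff)
qed

text \<open>
  All conditions on the entries of the generic matrix, in terms of vertices: the first case in each
  block is that of the rows of pivots.
\<close>

lemma generic_entry:
  assumes r: "r < n" and i: "i < n"
  shows "generic_matrix p q \<alpha> z $$ (r, w i) =
    (if i \<in> P \<union> L then
       if r \<in> P \<union> L then if r = i then 1 else 0
       else if r = partner i then - 1
       else if dominates r (partner i) then z r (w i) else 0
     else
       if r \<in> N \<union> L then if r = partner i then 1 else 0
       else if r = i then 1
       else if dominates r i then if crossing r i then - z r (w (partner i)) else z r (w i)
       else 0)"
proof -
  note e = generic_entry_raw[OF r i]
  have nc: "\<not> crossing r i" if "i \<notin> R" using that by (simp add: crossing_def)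
  consider (first) "i \<in> P \<union> L" | (last) "i \<in> N \<union> R" using signed_iff i by blast
  then show ?thesis
  proof cases
    case first
    have iR: "i \<notin> R" using first vertex_disjoint[of i] by blast
    have nl: "\<not> zero_last p q \<alpha> r (w i)" using w_bounds(1)[OF first] by (simp add: zero_last_def)
    show ?thesis
    proof (cases "r \<in> P \<union> L")
      case True
      then have "pivot_row r = r"
        using vertex_disjoint(1,3)[of r] by (auto simp: pivot_row_def)
      then have "\<exists>d<p. pivot p \<alpha> d = r"
        using w_bounds(1)[OF True] pivot_eq[OF r] by (intro exI[of _ "w r"]) simp
      then have "zero_first p q \<alpha> r (w i)"
        using w_bounds(1)[OF first] by (simp only: zero_first_def simp_thms)
      moreover have "\<not> (i \<in> L \<and> r = partner i)"
        using True left_facts(1)[of i] vertex_disjoint(1,3)[of r] by auto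
      ultimately show ?thesis
        unfolding e using True first iR by (simp only: if_True if_False simp_thms)
    next
      case False
      then have rl: "r \<in> N \<union> R" using signed_iff r by blast
      have "r \<noteq> i" using False first by blast
      moreover have "r = partner i \<longleftrightarrow> i \<in> L \<and> r = partner i"
        using first False signed_partner(1)[of i] by auto
      ultimately show ?thesis
        unfolding e using False first iR nl nc[OF iR] zero_first_iff[OF first rl] by (simp split: if_split)
    qed
  next
    case last
    have iL: "i \<notin> P \<union> L" "i \<notin> L" using last vertex_disjoint[of i] by blast+
    have nl: "\<not> zero_first p q \<alpha> r (w i)" using w_bounds(2)[OF last] by (simp add: zero_first_def)
    show ?thesis
    proof (cases "r \<in> N \<union> L")
      case True
      obtain k where k: "k \<in> N \<union> R" "pivot_row k = r"
      proof (cases "r \<in> L")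
        case True
        then show ?thesis using that[of "partner r"] left_facts(1)[of r] by (simp add: pivot_row_def)
      next
        case False
        then show ?thesis
          using that[of r] \<open>r \<in> N \<union> L\<close> vertex_disjoint(2)[of r] by (auto simp: pivot_row_def)
      qed
      then have "\<exists>d\<in>{p..<n}. pivot p \<alpha> d = r"
        using w_bounds(2)[of k] pivot_eq[of k] vertex_class_less(2)[of k] by (intro bexI[of _ "w k"]) auto
      then have "zero_last p q \<alpha> r (w i)"
        using w_bounds(2)[OF last] by (simp only: zero_last_def simp_thms)
      moreover have "r = i \<or> (i \<in> R \<and> r = partner i) \<longleftrightarrow> r = partner i"
      proof (cases "i \<in> R")
        case True
        then have "r \<noteq> i" using \<open>r \<in> N \<union> L\<close> vertex_disjoint(4)[of i] by blast
        with True show ?thesis by simp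
      next
        case False
        then show ?thesis using last signed_partner(2)[of i] by simp
      qed
      ultimately show ?thesis
        unfolding e using True iL by (simp only: if_True if_False simp_thms)
    next
      case False
      then have rl: "r \<in> P \<union> R" using signed_iff r by blast
      have "\<not> (i \<in> R \<and> r = partner i)" using False right_facts(1)[of i] by auto
      then show ?thesis
        unfolding e using False iL nl zero_last_iff[OF last rl]
        by (cases "r = i"; cases "i \<in> R") simp_all
    qed
  qed
qed

section \<open>Right multiplication by the base point\<close>

text \<open>The column \<open>w i\<close> of \<open>x\<close> is \<open>e\<^sub>i + mate_sign i * e\<^sub>k\<close>, where \<open>k = partner i\<close>.\<close>

definition mate_sign :: "nat \<Rightarrow> complex" where
  "mate_sign i = (if i \<in> L then - 1 else if i \<in> R then 1 else 0)"

lemma mate_sign_partner [simp]: "mate_sign (partner i) = - mate_sign i"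
proof -
  consider "i \<in> L" | "i \<in> R" | "i \<notin> L" "i \<notin> R" by blast
  then show ?thesis
  proof cases
    case 1
    then show ?thesis using left_facts(1,2)[of i] by (simp add: mate_sign_def)
  next
    case 2
    then show ?thesis using right_facts(1)[of i] vertex_disjoint(4)[of i] by (simp add: mate_sign_def)
  next
    case 3
    then show ?thesis by (simp add: mate_sign_def partner_def)
  qed
qed

lemma mate_sign_eq_0_iff: "i < n \<Longrightarrow> mate_sign i = 0 \<longleftrightarrow> i \<in> P \<or> i \<in> N"
  using signed_iff[of i] by (auto simp: mate_sign_def)

lemma mate_sign_square: "i < n \<Longrightarrow> i \<notin> P \<Longrightarrow> i \<notin> N \<Longrightarrow> mate_sign i * mate_sign i = 1"
  using signed_iff[of i] by (auto simp: mate_sign_def)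

lemma x_carrier [simp]: "x \<in> carrier_mat n n"
  by (simp add: x_clan_def generic_matrix_def)

lemma x_entry:
  assumes "r < n" "i < n"
  shows "x $$ (r, w i) = (if r = i then 1 else 0) + (if r = partner i then mate_sign i else 0)"
proof -
  have e: "x $$ (r, w i) = (if r = i \<or> (i \<in> R \<and> r = partner i) then 1
      else if i \<in> L \<and> r = partner i then - 1 else 0)"
    unfolding x_clan_def generic_entry_raw[OF assms] by simp
  consider "i \<in> L" "i \<notin> R" "partner i \<noteq> i" | "i \<in> R" "i \<notin> L" "partner i \<noteq> i" | "i \<notin> L" "i \<notin> R"
    using left_facts(3)[of i] right_facts(3)[of i] vertex_disjoint(3,4)[of i] by force
  then show ?thesis
    unfolding e by cases (auto simp: mate_sign_def)
qed

lemma mult_x_entry: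
  assumes "u \<in> carrier_mat n n" "r < n" "i < n"
  shows "(u * x) $$ (r, w i) = u $$ (r, i) + mate_sign i * u $$ (r, partner i)"
proof -
  have pi: "partner i < n" using assms(3) by (rule partner_less)
  have "(u * x) $$ (r, w i) = (\<Sum>k<n. u $$ (r, k) * x $$ (k, w i))"
    by (rule mult_entry[OF assms(1) x_carrier assms(2) w_less[OF assms(3)]])
  also have "\<dots> = (\<Sum>k<n. (if k = i then u $$ (r, i) else 0)
      + (if k = partner i then mate_sign i * u $$ (r, partner i) else 0))"
    using assms by (intro sum.cong) (auto simp: x_entry algebra_simps)
  also have "\<dots> = u $$ (r, i) + mate_sign i * u $$ (r, partner i)"
    using assms pi by (simp add: sum.distrib)
  finally show ?thesis .
qed

lemma sum_reindex_w: "(\<Sum>c<n. f c) = (\<Sum>a<n. f (w a))"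
proof -
  have "inj_on w {..<n}" by (auto simp: inj_on_def)
  moreover have "w ` {..<n} = {..<n}"
    by (rule endo_inj_surj) (auto simp: w_less inj_on_def)
  ultimately show ?thesis using sum.reindex[of w "{..<n}" f] by simp
qed

lemma x_mult_entry:
  assumes "D \<in> carrier_mat n n" "r < n" "b < n"
  shows "(x * D) $$ (r, b) = D $$ (w r, b) - mate_sign r * D $$ (w (partner r), b)"
proof -
  have pr: "partner r < n" using assms(2) by (rule partner_less)
  have "(x * D) $$ (r, b) = (\<Sum>c<n. x $$ (r, c) * D $$ (c, b))"
    by (rule mult_entry[OF x_carrier assms])
  also have "\<dots> = (\<Sum>a<n. x $$ (r, w a) * D $$ (w a, b))" by (rule sum_reindex_w)
  also have "\<dots> = (\<Sum>a<n. (if a = r then D $$ (w r, b) else 0)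
      + (if a = partner r then - mate_sign r * D $$ (w (partner r), b) else 0))"
  proof (rule sum.cong)
    fix a assume "a \<in> {..<n}"
    then have a: "a < n" by simp
    have "r = partner a \<longleftrightarrow> a = partner r" by auto
    then show "x $$ (r, w a) * D $$ (w a, b) = (if a = r then D $$ (w r, b) else 0)
      + (if a = partner r then - mate_sign r * D $$ (w (partner r), b) else 0)"
      unfolding x_entry[OF assms(2) a] by (auto simp: algebra_simps)
  qed simp
  also have "\<dots> = D $$ (w r, b) - mate_sign r * D $$ (w (partner r), b)"
    using assms pr by (simp add: sum.distrib)
  finally show ?thesis .
qed

lemma mat_eq_by_w:
  assumes "A \<in> carrier_mat n n" "B \<in> carrier_mat n n"
    "\<And>r i. r < n \<Longrightarrow> i < n \<Longrightarrow> A $$ (r, w i) = B $$ (r, w i)"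
  shows "A = B"
proof (rule eq_matI)
  fix r c assume "r < dim_row B" "c < dim_col B"
  then have rc: "r < n" "c < n" using assms(2) by auto
  then obtain i where "i < n" "w i = c" using w_surj by blast
  then show "A $$ (r, c) = B $$ (r, c)" using assms(3) rc by blast
qed (use assms in auto)

text \<open>
  This is \<open>M x\<inverse>\<close>: solving \<open>x e\<^sub>a = e\<^sub>i - e\<^sub>j\<close>, \<open>x e\<^sub>b = e\<^sub>i + e\<^sub>j\<close> for a matching \<open>(i, j)\<close>, with
  \<open>a = w i\<close> and \<open>b = w j\<close>, gives \<open>x\<inverse> e\<^sub>i = (e\<^sub>a + e\<^sub>b) / 2\<close> and \<open>x\<inverse> e\<^sub>j = (e\<^sub>b - e\<^sub>a) / 2\<close>.
\<close>

definition divide_x :: "complex mat \<Rightarrow> complex mat" where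
  "divide_x M = mat n n (\<lambda>(r, i).
     if mate_sign i = 0 then M $$ (r, w i)
     else (M $$ (r, w i) - mate_sign i * M $$ (r, w (partner i))) / 2)"

lemma divide_x_carrier [simp]: "divide_x M \<in> carrier_mat n n"
  by (simp add: divide_x_def)

lemma divide_x_entry:
  "r < n \<Longrightarrow> i < n \<Longrightarrow> divide_x M $$ (r, i) =
     (if mate_sign i = 0 then M $$ (r, w i)
      else (M $$ (r, w i) - mate_sign i * M $$ (r, w (partner i))) / 2)"
  by (simp add: divide_x_def)

lemma divide_x_mult_x:
  assumes "M \<in> carrier_mat n n"
  shows "divide_x M * x = M"
proof (rule mat_eq_by_w)
  fix r i assume r: "r < n" and i: "i < n"
  show "(divide_x M * x) $$ (r, w i) = M $$ (r, w i)"
  proof (cases "mate_sign i = 0")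
    case True
    then show ?thesis using r i partner_less[OF i] by (simp add: mult_x_entry divide_x_entry)
  next
    case False
    then have s: "mate_sign i * (mate_sign i * z) = z" for z
      using mate_sign_eq_0_iff[OF i] mate_sign_square[OF i] by (metis mult.assoc mult_1)
    have "(divide_x M * x) $$ (r, w i) =
        (M $$ (r, w i) - mate_sign i * M $$ (r, w (partner i))) / 2
        + mate_sign i * ((M $$ (r, w (partner i)) + mate_sign i * M $$ (r, w i)) / 2)"
      using False r i partner_less[OF i] by (simp add: mult_x_entry divide_x_entry)
    also have "\<dots> = M $$ (r, w i)"
      using s[of "M $$ (r, w i)"] by (simp add: field_simps)
    finally show ?thesis .
  qed
qed (use assms mult_carrier_mat[OF divide_x_carrier x_carrier] in auto)

lemma x_GL: "x \<in> carrier (GL n)"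
  using GL_of_left_inverse(1)[OF x_carrier divide_x_carrier divide_x_mult_x] by simp

section \<open>The group \<open>U\<^sup>- \<inter> \<psi>(U\<^sup>-)\<close>\<close>

definition signum :: "nat \<Rightarrow> complex" where
  "signum i = (if i \<in> P then 1 else - 1)"

lemma signum_partner [simp]: "signum (partner i) = signum i"
proof -
  have "partner i \<in> P \<longleftrightarrow> i \<in> P"
    using signed_partner(1)[of i] signed_partner(1)[of "partner i"] by auto
  then show ?thesis by (simp add: signum_def)
qed

lemma signum_square [simp]: "signum i * signum i = 1" "signum i * (signum i * z) = z" "signum i \<noteq> 0"
  by (simp_all add: signum_def)

text \<open>This is \<open>x I x\<inverse>\<close> for \<open>I = I_pq p q\<close>, by lemma \<open>base_involution_mult_x\<close> below.\<close>

definition base_involution :: "complex mat" where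
  "base_involution = mat n n (\<lambda>(r, c). if c = partner r then signum r else 0)"

lemma base_involution_carrier [simp]: "base_involution \<in> carrier_mat n n"
  by (simp add: base_involution_def)

lemma base_involution_mult_entry:
  assumes "A \<in> carrier_mat n n" "r < n" "c < n"
  shows "(base_involution * A) $$ (r, c) = signum r * A $$ (partner r, c)"
proof -
  have "(base_involution * A) $$ (r, c) = (\<Sum>k<n. base_involution $$ (r, k) * A $$ (k, c))"
    by (rule mult_entry[OF base_involution_carrier assms])
  also have "\<dots> = (\<Sum>k<n. if k = partner r then signum r * A $$ (partner r, c) else 0)"
    using assms by (intro sum.cong) (auto simp: base_involution_def)
  finally show ?thesis using partner_less[OF assms(2)] by simp
qed

lemma mult_base_involution_entry:
  assumes "A \<in> carrier_mat n n" "r < n" "c < n"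
  shows "(A * base_involution) $$ (r, c) = signum c * A $$ (r, partner c)"
proof -
  have "(A * base_involution) $$ (r, c) = (\<Sum>k<n. A $$ (r, k) * base_involution $$ (k, c))"
    by (rule mult_entry[OF assms(1) base_involution_carrier assms(2,3)])
  also have "\<dots> = (\<Sum>k<n. if k = partner c then signum c * A $$ (r, partner c) else 0)"
  proof (rule sum.cong)
    fix k assume "k \<in> {..<n}"
    then have k: "k < n" by simp
    have "c = partner k \<longleftrightarrow> k = partner c" by auto
    then show "A $$ (r, k) * base_involution $$ (k, c) = (if k = partner c then signum c * A $$ (r, partner c) else 0)"
      using k assms by (auto simp: base_involution_def)
  qed simp
  finally show ?thesis using partner_less[OF assms(3)] by simp
qed

lemma base_involution_square: "base_involution * base_involution = 1\<^sub>m n"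
proof (rule eq_matI)
  fix r c assume "r < dim_row (1\<^sub>m n :: complex mat)" "c < dim_col (1\<^sub>m n :: complex mat)"
  then have rc: "r < n" "c < n" by auto
  show "(base_involution * base_involution) $$ (r, c) = 1\<^sub>m n $$ (r, c)"
    unfolding base_involution_mult_entry[OF base_involution_carrier rc] using rc partner_less[OF rc(1)]
    by (auto simp: base_involution_def)
qed (simp_all add: base_involution_def)

lemma base_involution_mult_x: "base_involution * x = x * I_pq p q"
proof (rule mat_eq_by_w)
  show "base_involution * x \<in> carrier_mat n n" "x * I_pq p q \<in> carrier_mat n n"
    by (rule mult_carrier_mat[of _ n n]; simp)+
  fix r i assume r: "r < n" and i: "i < n"
  have e: "partner r = i \<longleftrightarrow> r = partner i" "partner r = partner i \<longleftrightarrow> r = i"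
    by (metis partner_partner)+
  have "signum r * ((if r = partner i then 1 else 0) + (if r = i then mate_sign i else 0)) =
    (if w i < p then 1 else - 1) * ((if r = i then 1 else 0) + (if r = partner i then mate_sign i else 0))"
    unfolding w_less_p_iff[OF i]
    by (cases rule: vertex_cases[OF i]) (auto simp: signum_def mate_sign_def)
  then show "(base_involution * x) $$ (r, w i) = (x * I_pq p q) $$ (r, w i)"
    unfolding base_involution_mult_entry[OF x_carrier r w_less[OF i]] mult_I_pq_right[OF x_carrier r w_less[OF i]]
      x_entry[OF r i] x_entry[OF partner_less[OF r] i] e .
qed

lemmas square_simps = mult_assoc_square[of _ n] mult_carrier_mat[of _ n n]

text \<open>With \<open>s = x I x\<inverse>\<close>, one has \<open>x \<theta>(x)\<inverse> = x I x\<inverse> I = s I\<close>.\<close>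

lemma eta_rep_eq: "eta_rep p q \<alpha> = base_involution * I_pq p q"
proof -
  let ?I = "I_pq p q"
  have I: "?I * ?I = 1\<^sub>m n" "?I \<in> carrier_mat n n" by (simp_all add: I_pq_square)
  have IG: "?I \<in> carrier (GL n)" using GL_of_left_inverse(1)[OF I(2,2,1)] .
  have th: "theta p q x = ?I * x * ?I" by (simp add: theta_def)
  have tG: "theta p q x \<in> carrier (GL n)" unfolding th by (intro GL_mult IG x_GL)
  then have tc: "theta p q x \<in> carrier_mat n n" by (simp add: carrier_GL_iff)
  note inv = GL_inv[OF tG]
  have "base_involution * ?I * theta p q x = x"
    unfolding th using I
    by (simp add: square_simps cancel_involution[OF I] cancel_involution[OF base_involution_square]
        base_involution_mult_x[symmetric])
  then have "eta_rep p q \<alpha> = base_involution * ?I * theta p q x * inv\<^bsub>GL n\<^esub> (theta p q x)"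
    by (simp add: eta_rep_def)
  also have "\<dots> = base_involution * ?I * (theta p q x * inv\<^bsub>GL n\<^esub> (theta p q x))"
    by (rule mult_assoc_square[OF mult_carrier_mat[OF base_involution_carrier I(2)] tc inv(2)])
  also have "\<dots> = base_involution * ?I"
    unfolding inv(3) by (rule right_mult_one_mat[OF mult_carrier_mat[OF base_involution_carrier I(2)]])
  finally show ?thesis .
qed

text \<open>The factors \<open>I\<close> of \<open>\<eta>\<close> and of \<open>\<theta>\<close> cancel.\<close>

lemma psi_eq:
  assumes "g \<in> carrier_mat n n"
  shows "psi p q \<alpha> g = base_involution * g * base_involution"
proof -
  let ?I = "I_pq p q"
  have I: "?I * ?I = 1\<^sub>m n" "?I \<in> carrier_mat n n" by (simp_all add: I_pq_square)
  note c = I(2) base_involution_carrier assms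
  have "?I * base_involution * (base_involution * ?I) = 1\<^sub>m n"
    using c by (simp add: square_simps cancel_involution[OF base_involution_square] I)
  then have inv: "inv\<^bsub>GL n\<^esub> (base_involution * ?I) = ?I * base_involution"
    using c by (intro GL_of_left_inverse(3)) (simp_all add: square_simps)
  show ?thesis
    unfolding psi_def eta_rep_eq inv theta_def
    using c by (simp add: square_simps cancel_involution[OF I])
qed

definition U_clan :: "complex mat set" where
  "U_clan = {u \<in> carrier_mat n n. (\<forall>i<n. u $$ (i, i) = 1) \<and>
     (\<forall>r<n. \<forall>c<n. u $$ (r, c) \<noteq> 0 \<longrightarrow> dominates r c)}"

lemma U_clan_carrier: "u \<in> U_clan \<Longrightarrow> u \<in> carrier_mat n n"
  by (simp add: U_clan_def)

lemma conj_base_involution_carrier: "g \<in> carrier_mat n n \<Longrightarrow> base_involution * g * base_involution \<in> carrier_mat n n"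
  by (simp add: square_simps)

lemma conj_base_involution_entry:
  assumes "g \<in> carrier_mat n n" "r < n" "c < n"
  shows "(base_involution * g * base_involution) $$ (r, c) = signum r * signum c * g $$ (partner r, partner c)"
proof -
  have "base_involution * g \<in> carrier_mat n n" using assms by (simp add: square_simps)
  from mult_base_involution_entry[OF this assms(2,3)] show ?thesis
    using base_involution_mult_entry[OF assms(1,2) partner_less[OF assms(3)]] by simp
qed

lemma conj_base_involution_twice: "g \<in> carrier_mat n n \<Longrightarrow> base_involution * (base_involution * g * base_involution) * base_involution = g"
  by (simp add: square_simps cancel_involution[OF base_involution_square] base_involution_square)

text \<open>
  Conjugation by the signed permutation matrix moves the entry at \<open>(r, c)\<close> to
  \<open>(partner r, partner c)\<close>, up to sign.
\<close>

lemma U_clan_iff: "u \<in> U_clan \<longleftrightarrow> u \<in> U_minus n \<and> base_involution * u * base_involution \<in> U_minus n"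
proof
  assume u: "u \<in> U_clan"
  have c: "u \<in> carrier_mat n n" using u by (rule U_clan_carrier)
  have "u \<in> U_minus n"
    using u by (force simp: U_clan_def U_minus_def dominates_def)
  moreover have "base_involution * u * base_involution \<in> U_minus n"
    unfolding U_minus_def
  proof (intro CollectI conjI allI impI)
    show "base_involution * u * base_involution \<in> carrier_mat n n" using c by (rule conj_base_involution_carrier)
    show "(base_involution * u * base_involution) $$ (i, i) = 1" if "i < n" for i
      using conj_base_involution_entry[OF c that that] u partner_less[OF that] by (simp add: U_clan_def)
    show "(base_involution * u * base_involution) $$ (i, j) = 0" if "i < n" "j < n" "i < j" for i j
    proof -
      have "\<not> dominates (partner i) (partner j)" using that by (simp add: dominates_def)
      then have "u $$ (partner i, partner j) = 0"
        using u partner_less that unfolding U_clan_def by blast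
      then show ?thesis using conj_base_involution_entry[OF c that(1,2)] by simp
    qed
  qed
  ultimately show "u \<in> U_minus n \<and> base_involution * u * base_involution \<in> U_minus n" ..
next
  assume u: "u \<in> U_minus n \<and> base_involution * u * base_involution \<in> U_minus n"
  then have c: "u \<in> carrier_mat n n" by (simp add: U_minus_def)
  have "dominates r k" if rk: "r < n" "k < n" and nz: "u $$ (r, k) \<noteq> 0" for r k
  proof -
    note p = partner_less[OF rk(1)] partner_less[OF rk(2)]
    have "(base_involution * u * base_involution) $$ (partner r, partner k) \<noteq> 0"
      using conj_base_involution_entry[OF c p] nz by simp
    then have "\<not> partner r < partner k" using u p unfolding U_minus_def by blast
    moreover have "\<not> r < k" using u rk nz unfolding U_minus_def by blast
    ultimately show ?thesis by (simp add: dominates_def)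
  qed
  then show "u \<in> U_clan" using u c by (simp add: U_clan_def U_minus_def)
qed

lemma U_minus_Int_psi_eq: "U_minus n \<inter> psi p q \<alpha> ` U_minus n = U_clan"
proof (intro subset_antisym subsetI)
  fix u assume u: "u \<in> U_minus n \<inter> psi p q \<alpha> ` U_minus n"
  then obtain v where v: "v \<in> U_minus n" "u = psi p q \<alpha> v" by blast
  then have vc: "v \<in> carrier_mat n n" by (simp add: U_minus_def)
  have "base_involution * u * base_involution = v" using v(2) psi_eq[OF vc] conj_base_involution_twice[OF vc] by simp
  then show "u \<in> U_clan" using u v(1) by (simp add: U_clan_iff)
next
  fix u assume u: "u \<in> U_clan"
  have c: "u \<in> carrier_mat n n" using u by (rule U_clan_carrier)
  have "u = psi p q \<alpha> (base_involution * u * base_involution)"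
    using psi_eq[OF conj_base_involution_carrier[OF c]] conj_base_involution_twice[OF c] by simp
  then show "u \<in> U_minus n \<inter> psi p q \<alpha> ` U_minus n" using u unfolding U_clan_iff by blast
qed

lemma U_clan_GL: "u \<in> U_clan \<Longrightarrow> u \<in> carrier (GL n)"
  using U_minus_GL U_clan_iff by blast

text \<open>Both \<open>U\<^sup>-\<close> and its conjugate are groups.\<close>

lemma U_clan_divide:
  assumes u: "u \<in> U_clan" and h: "h \<in> U_clan"
  shows "u * inv\<^bsub>GL n\<^esub> h \<in> U_clan"
proof -
  let ?h = "inv\<^bsub>GL n\<^esub> h"
  note hi = GL_inv[OF U_clan_GL[OF h]]
  have c: "u \<in> carrier_mat n n" "h \<in> carrier_mat n n" using u h U_clan_carrier by blast+
  have conj_mult: "base_involution * (a * b) * base_involution = (base_involution * a * base_involution) * (base_involution * b * base_involution)"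
    if "a \<in> carrier_mat n n" "b \<in> carrier_mat n n" for a b
    using that by (simp add: square_simps cancel_involution[OF base_involution_square])
  have "base_involution * h * base_involution * (base_involution * ?h * base_involution) = 1\<^sub>m n"
    unfolding conj_mult[OF c(2) hi(2), symmetric] hi(3)
    by (simp add: right_mult_one_mat[OF base_involution_carrier] base_involution_square)
  moreover have hU: "h \<in> U_minus n" "base_involution * h * base_involution \<in> U_minus n"
    using h unfolding U_clan_iff by (rule conjunct1, rule conjunct2)
  ultimately have "base_involution * ?h * base_involution \<in> U_minus n"
    using U_minus_inverse[OF hU(2) conj_base_involution_carrier[OF hi(2)]] by blast
  moreover have "?h \<in> U_minus n"
    by (rule U_minus_inverse[OF hU(1) hi(2,3)])
  ultimately show ?thesis
    using u conj_mult[OF c(1) hi(2)] U_minus_mult unfolding U_clan_iff by simp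
qed

section \<open>Pivot blocks\<close>

lemma dominates_partner_iff: "dominates (partner r) (partner c) \<longleftrightarrow> dominates r c"
  by (auto simp: dominates_def)

text \<open>
  For a row \<open>r\<close> that is not a left end, \<open>partner r \<le> r\<close>, so the stronger of the inequalities of
  \<open>dominates r (partner j)\<close> is \<open>j \<le> partner r\<close>, and it implies those of \<open>dominates r j\<close>.
\<close>

lemma dominates_right_end:
  assumes r: "r \<in> P \<union> (N \<union> R)" and j: "j \<in> R" and d: "dominates r (partner j)"
  shows "dominates r j"
proof (cases "r \<in> R")
  case True
  then show ?thesis
    using d right_facts(3)[OF j] right_facts(3)[OF True] by (simp add: dominates_def)
next
  case False
  then have "partner r = r" using r signed_partner by blast
  then show ?thesis using d by (simp add: dominates_def)
qed

text \<open>
  The two square blocks, of sizes \<open>p\<close> and \<open>q\<close>, formed by the pivot rows of the columns of the same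
  block.
\<close>

definition pivot_block :: "complex mat \<Rightarrow> complex mat" where
  "pivot_block g = mat n n (\<lambda>(a, b). if (a < p) = (b < p) then g $$ (pivot p \<alpha> a, b) else 0)"

lemma pivot_block_carrier [simp]: "pivot_block g \<in> carrier_mat n n"
  by (simp add: pivot_block_def)

lemma off_block_zero_pivot_block: "off_block_zero p n (pivot_block g)"
  by (auto simp: off_block_zero_def pivot_block_def)

lemma pivot_block_entry:
  assumes "a < n" "b < n"
  shows "pivot_block g $$ (w a, w b) =
    (if (a \<in> P \<union> L) = (b \<in> P \<union> L) then g $$ (pivot_row a, w b) else 0)"
  unfolding w_less_p_iff[OF assms(1), symmetric] w_less_p_iff[OF assms(2), symmetric]
  using assms by (simp add: pivot_block_def w_less pivot_eq)

lemma pivot_less: 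
  assumes "a < n" shows "pivot p \<alpha> a < n"
proof -
  obtain i where i: "i < n" "w i = a" using w_surj[OF assms] by blast
  have "pivot_row i < n" using i(1) partner_less[of i] by (simp add: pivot_row_def)
  then show ?thesis using pivot_eq[OF i(1)] i(2) by simp
qed

text \<open>
  Each block is a set of rows cut out of one block of columns, and \<open>k\<close> acts on the columns of each block
  separately.
\<close>

lemma pivot_block_mult_K:
  assumes g: "g \<in> carrier_mat n n" and k: "k \<in> K_grp p q"
  shows "pivot_block (g * k) = pivot_block g * k"
proof -
  have kc: "k \<in> carrier_mat n n" and ko: "off_block_zero p n k"
    using k by (simp_all add: K_grp_iff carrier_GL_iff)
  show ?thesis
  proof (rule eq_matI)
    fix a b assume "a < dim_row (pivot_block g * k)" "b < dim_col (pivot_block g * k)"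
    then have ab: "a < n" "b < n" using kc pivot_block_carrier[of g] by (auto simp: pivot_block_def)
    have "(pivot_block g * k) $$ (a, b) = (\<Sum>c<n. pivot_block g $$ (a, c) * k $$ (c, b))"
      by (rule mult_entry[OF pivot_block_carrier kc ab])
    also have "\<dots> = (\<Sum>c<n. if (a < p) = (b < p) then g $$ (pivot p \<alpha> a, c) * k $$ (c, b) else 0)"
    proof (rule sum.cong)
      fix c assume "c \<in> {..<n}"
      then have c: "c < n" by simp
      have "(c < p) \<noteq> (b < p) \<Longrightarrow> k $$ (c, b) = 0"
        using ko c ab(2) unfolding off_block_zero_def by blast
      then show "pivot_block g $$ (a, c) * k $$ (c, b) =
          (if (a < p) = (b < p) then g $$ (pivot p \<alpha> a, c) * k $$ (c, b) else 0)"
        using ab c by (cases "(c < p) = (b < p)") (simp_all add: pivot_block_def)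
    qed simp
    also have "\<dots> = (if (a < p) = (b < p) then (g * k) $$ (pivot p \<alpha> a, b) else 0)"
      using mult_entry[OF g kc pivot_less[OF ab(1)] ab(2)] by simp
    also have "\<dots> = pivot_block (g * k) $$ (a, b)"
      using ab by (simp add: pivot_block_def)
    finally show "pivot_block (g * k) $$ (a, b) = (pivot_block g * k) $$ (a, b)" by simp
  qed (use kc in \<open>auto simp: pivot_block_def\<close>)
qed

lemma pivot_block_eq_one_iff:
  assumes "M \<in> carrier_mat n n"
  shows "pivot_block M = 1\<^sub>m n \<longleftrightarrow>
    (\<forall>r<n. \<forall>i<n. (r \<in> P \<union> L \<longrightarrow> i \<in> P \<union> L \<longrightarrow> M $$ (r, w i) = (if r = i then 1 else 0)) \<and>
       (r \<in> N \<union> L \<longrightarrow> i \<in> N \<union> R \<longrightarrow> M $$ (r, w i) = (if r = partner i then 1 else 0)))"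
    (is "?l \<longleftrightarrow> ?r")
proof
  assume one: ?l
  have entry: "pivot_block M $$ (w a, w b) = (if a = b then 1 else 0)" if "a < n" "b < n" for a b
    unfolding one using that by (simp add: w_less)
  show ?r
  proof (intro allI impI conjI)
    fix r i assume r: "r < n" and i: "i < n"
    show "M $$ (r, w i) = (if r = i then 1 else 0)" if "r \<in> P \<union> L" "i \<in> P \<union> L"
    proof -
      have "pivot_row r = r" using that(1) vertex_disjoint(1,3)[of r] by (auto simp: pivot_row_def)
      then show ?thesis using entry[OF r i] that pivot_block_entry[OF r i] by simp
    qed
    show "M $$ (r, w i) = (if r = partner i then 1 else 0)" if rl: "r \<in> N \<union> L" and il: "i \<in> N \<union> R"
    proof -
      have a: "partner r \<in> N \<union> R" "pivot_row (partner r) = r"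
        using rl left_facts(1)[of r] signed_partner(2)[of r] vertex_disjoint(2)[of r]
        by (auto simp: pivot_row_def)
      have nf: "partner r \<notin> P \<union> L" "i \<notin> P \<union> L"
        using a(1) il vertex_disjoint(2,4)[of "partner r"] vertex_disjoint(2,4)[of i] by blast+
      have "M $$ (r, w i) = (if partner r = i then 1 else 0)"
        using entry[OF partner_less[OF r] i] pivot_block_entry[OF partner_less[OF r] i, of M] nf a(2)
        by simp
      moreover have "partner r = i \<longleftrightarrow> r = partner i" by auto
      ultimately show ?thesis by simp
    qed
  qed
next
  assume r: ?r
  have first: "M $$ (a, w b) = (if a = b then 1 else 0)"
    if "a < n" "b < n" "a \<in> P \<union> L" "b \<in> P \<union> L" for a b
    using r that by blast
  have last: "M $$ (a, w b) = (if a = partner b then 1 else 0)"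
    if "a < n" "b < n" "a \<in> N \<union> L" "b \<in> N \<union> R" for a b
    using r that by blast
  show ?l
  proof (rule mat_eq_by_w)
    fix r b assume r: "r < n" and b: "b < n"
    obtain a where a: "a < n" "w a = r" using w_surj[OF r] by blast
    note ar = a(2) and a = a(1)
    have one: "1\<^sub>m n $$ (w a, w b) = (if a = b then 1 else (0 :: complex))"
      using a b by (simp add: w_less)
    show "pivot_block M $$ (r, w b) = 1\<^sub>m n $$ (r, w b)"
    proof (cases "(a \<in> P \<union> L) = (b \<in> P \<union> L)")
      case False
      then have "a \<noteq> b" by blast
      then show ?thesis using False unfolding ar[symmetric] pivot_block_entry[OF a b] one by (simp only: if_False)
    next
      case True
      have "M $$ (pivot_row a, w b) = (if a = b then 1 else 0)"
      proof (cases "a \<in> P \<union> L")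
        case aF: True
        then have "pivot_row a = a" using vertex_disjoint(1,3)[of a] by (auto simp: pivot_row_def)
        then show ?thesis using first[OF a b] aF True by simp
      next
        case False
        then have l: "a \<in> N \<union> R" "b \<in> N \<union> R" using a b True signed_iff by blast+
        have "pivot_row b = partner b" using l(2) signed_partner(2)[of b] by (auto simp: pivot_row_def)
        then have "pivot_row a = partner b \<longleftrightarrow> a = b" using pivot_row_inj[OF l] by auto
        moreover have "pivot_row a < n" using partner_less[OF a] a by (simp add: pivot_row_def)
        ultimately show ?thesis using last[OF _ b pivot_row_last[OF l(1)] l(2)] by simp
      qed
      then show ?thesis using True unfolding ar[symmetric] pivot_block_entry[OF a b] one by (simp only: if_True HOL.refl)
    qed
  qed simp_all
qed

section \<open>\<open>S_clan\<close> as a set of normal forms\<close>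

lemma not_first_iff: "i < n \<Longrightarrow> i \<notin> P \<union> L \<longleftrightarrow> i \<in> N \<union> R"
  using signed_iff[of i] vertex_disjoint[of i] by blast

lemma not_pivot_first_iff: "i < n \<Longrightarrow> i \<notin> N \<union> L \<longleftrightarrow> i \<in> P \<union> R"
  using signed_iff[of i] vertex_disjoint[of i] by blast

text \<open>
  For a left end \<open>i\<close> the column of \<open>M x\<inverse>\<close> is half of the sum of the columns \<open>w i\<close> and
  \<open>w (partner i)\<close> of \<open>M\<close>. Except in row \<open>i\<close>, both are supported where \<open>dominates r (partner i)\<close>.
  This allows rows \<open>r\<close> without \<open>dominates r i\<close>: the row \<open>partner i\<close>, with entries \<open>- 1\<close> and \<open>1\<close>, and
  those of right ends \<open>r\<close> for which \<open>crossing r (partner i)\<close>. There the two entries are opposite.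
\<close>

lemma divide_x_generic_support:
  fixes z
  defines "M \<equiv> generic_matrix p q \<alpha> z"
  assumes r: "r < n" and i: "i < n" and ri: "r \<noteq> i" and nd: "\<not> dominates r i"
  shows "divide_x M $$ (r, i) = 0"
proof -
  note ge = generic_entry[OF r, of _ z, folded M_def]
  note pi = partner_less[OF i]
  show ?thesis
    using i
  proof (cases rule: vertex_cases)
    case plus
    then have "M $$ (r, w i) = 0"
      unfolding ge[OF i] using ri nd by simp
    then show ?thesis using plus r i by (simp add: divide_x_entry mate_sign_def)
  next
    case minus
    then have "M $$ (r, w i) = 0"
      unfolding ge[OF i] using ri nd by simp
    then show ?thesis using minus r i by (simp add: divide_x_entry mate_sign_def)
  next
    case left
    have "M $$ (r, w i) + M $$ (r, w (partner i)) = 0"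
      using r
    proof (cases rule: vertex_cases)
      case plus
      then have "\<not> dominates r (partner i)" "r \<noteq> partner i"
        using nd dominates_partner_iff[of r i] left by auto
      then show ?thesis using plus left ri unfolding ge[OF i] ge[OF pi] by simp
    next
      case minus
      then have "\<not> dominates r (partner i)" "r \<noteq> partner i"
        using nd dominates_partner_iff[of r i] left by auto
      then show ?thesis using minus left ri unfolding ge[OF i] ge[OF pi] by simp
    next
      case r_left: left
      then show ?thesis using left ri unfolding ge[OF i] ge[OF pi] by simp
    next
      case right
      show ?thesis
      proof (cases "r = partner i \<or> \<not> dominates r (partner i) \<or> crossing r (partner i)")
        case True
        then show ?thesis using left right ri unfolding ge[OF i] ge[OF pi] by auto
      next
        case False
        \<comment> \<open>The matchings do not cross, so the one of \<open>r\<close> begins after \<open>partner i\<close>.\<close>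
        then have "partner i < r" "i \<le> partner r" "i \<noteq> partner r"
          using partner_partner[of r] by (auto simp: dominates_def)
        then have "\<not> partner r < partner i"
          using False left right by (auto simp: crossing_def)
        then have "dominates r i" using \<open>partner i < r\<close> left by (simp add: dominates_def)
        then show ?thesis using nd by simp
      qed
    qed
    then show ?thesis using left r i by (simp add: divide_x_entry mate_sign_def)
  next
    case right
    have e: "r = partner (partner i) \<longleftrightarrow> r = i" by simp
    have "M $$ (r, w i) - M $$ (r, w (partner i)) = 0"
      using right ri nd unfolding ge[OF i] ge[OF pi] e
      by (cases rule: vertex_cases[OF r]) auto
    then show ?thesis using right r i by (simp add: divide_x_entry mate_sign_def)
  qed
qed

lemma divide_x_generic_diagonal:
  assumes i: "i < n"
  shows "divide_x (generic_matrix p q \<alpha> z) $$ (i, i) = 1"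
  using divide_x_entry[OF i i, of "generic_matrix p q \<alpha> z"]
  unfolding generic_entry_raw[OF i i] generic_entry_raw[OF i partner_less[OF i]]
  by (cases rule: vertex_cases[OF i]) (simp_all add: mate_sign_def)

lemma S_clan_factorization:
  assumes "M \<in> S_clan p q \<alpha>"
  shows "divide_x M \<in> U_clan" "divide_x M * x = M" "pivot_block M = 1\<^sub>m n" "M \<in> carrier_mat n n"
proof -
  obtain z where M: "M = generic_matrix p q \<alpha> z" using assms by (auto simp: S_clan_def)
  show Mc: "M \<in> carrier_mat n n" by (simp add: M generic_matrix_def)
  then show "divide_x M * x = M" by (rule divide_x_mult_x)
  show "divide_x M \<in> U_clan"
    unfolding U_clan_def M
    using divide_x_generic_support[of _ _ z] divide_x_generic_diagonal[of _ z]
    by (auto simp: dominates_def)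
  show "pivot_block M = 1\<^sub>m n"
    unfolding pivot_block_eq_one_iff[OF Mc]
  proof (intro allI impI conjI)
    fix r i assume r: "r < n" and i: "i < n"
    show "M $$ (r, w i) = (if r = i then 1 else 0)" if "r \<in> P \<union> L" "i \<in> P \<union> L"
      unfolding M generic_entry[OF r i] using that by simp
    show "M $$ (r, w i) = (if r = partner i then 1 else 0)" if rl: "r \<in> N \<union> L" and il: "i \<in> N \<union> R"
    proof -
      have "i \<notin> P \<union> L" using not_first_iff[OF i] il by blast
      then show ?thesis unfolding M generic_entry[OF r i] using rl by (simp only: if_True if_False)
    qed
  qed
qed

text \<open>
  The entries of \<open>u x\<close> serve as their own coordinates. At a crossing, two entries in row \<open>r\<close> of \<open>u\<close>
  contribute to the two tied entries of \<open>u x\<close>. One of them is zero, as its position is not admissible,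
  and the other one enters with opposite signs.
\<close>

lemma S_clanI:
  assumes u: "u \<in> U_clan" and one: "pivot_block (u * x) = 1\<^sub>m n"
  shows "u * x \<in> S_clan p q \<alpha>"
proof -
  define M where "M = u * x"
  have uc: "u \<in> carrier_mat n n" using u by (rule U_clan_carrier)
  have Mc: "M \<in> carrier_mat n n" unfolding M_def by (rule mult_carrier_mat[OF uc x_carrier])
  have uz: "u $$ (r, c) = 0" if "\<not> dominates r c" "r < n" "c < n" for r c
    using u that unfolding U_clan_def by blast
  have ud: "u $$ (i, i) = 1" if "i < n" for i using u that unfolding U_clan_def by blast
  have "M = generic_matrix p q \<alpha> (\<lambda>r c. M $$ (r, c))"
  proof (rule mat_eq_by_w)
    fix r i assume r: "r < n" and i: "i < n"
    note pi = partner_less[OF i]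
    have e: "M $$ (r, w i) = u $$ (r, i) + mate_sign i * u $$ (r, partner i)"
      unfolding M_def by (rule mult_x_entry[OF uc r i])
    have e': "M $$ (r, w (partner i)) = u $$ (r, partner i) - mate_sign i * u $$ (r, i)"
      unfolding M_def using mult_x_entry[OF uc r pi] by simp
    have one': "pivot_block M = 1\<^sub>m n" using one by (simp add: M_def)
    note piv = one'[unfolded pivot_block_eq_one_iff[OF Mc], rule_format, OF r i]
    consider (fp) "i \<in> P \<union> L" "r \<in> P \<union> L" | (ff) "i \<in> P \<union> L" "r \<notin> P \<union> L" "r \<in> N \<union> R"
      | (lp) "i \<notin> P \<union> L" "i \<in> N \<union> R" "r \<in> N \<union> L"
      | (lf) "i \<notin> P \<union> L" "i \<in> N \<union> R" "r \<notin> N \<union> L" "r \<in> P \<union> R"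
      using not_first_iff[OF r] not_first_iff[OF i] not_pivot_first_iff[OF r] by blast
    then show "M $$ (r, w i) = generic_matrix p q \<alpha> (\<lambda>r c. M $$ (r, c)) $$ (r, w i)"
    proof cases
      case fp
      then show ?thesis using piv unfolding generic_entry[OF r i] by simp
    next
      case lp
      then show ?thesis using piv unfolding generic_entry[OF r i] by simp
    next
      case ff
      have "M $$ (r, w i) = - 1" if rp: "r = partner i"
      proof -
        have "i \<in> L" using ff rp signed_partner(1)[of i] by auto
        moreover from this have "\<not> dominates r i"
          using rp left_facts(3)[of i] by (simp add: dominates_def)
        ultimately show ?thesis using e rp uz[OF _ r i] ud[OF r] by (simp add: mate_sign_def)
      qed
      moreover have "M $$ (r, w i) = 0" if "\<not> dominates r (partner i)"
      proof -
        have "\<not> dominates r i"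
        proof (cases "i \<in> L")
          case True
          then show ?thesis using dominates_right_end[of r "partner i"] that left_facts(1)[of i] ff by auto
        next
          case False
          then show ?thesis using that signed_partner(1)[of i] ff by auto
        qed
        then show ?thesis using e uz r i pi that by simp
      qed
      ultimately show ?thesis using ff unfolding generic_entry[OF r i] by simp
    next
      case lf
      have "M $$ (r, w i) = 1" if rp: "r = i"
      proof -
        have iR: "i \<in> R" using lf rp vertex_disjoint(2)[of i] by auto
        then have "\<not> dominates r (partner i)"
          using rp right_facts(3)[of i] by (simp add: dominates_def)
        then show ?thesis using e rp uz[OF _ r pi] ud[OF r] by simp
      qed
      moreover have "M $$ (r, w i) = 0" if nd: "\<not> dominates r i"
      proof -
        have "\<not> dominates r (partner i)"
        proof (cases "i \<in> R")
          case True
          then show ?thesis using dominates_right_end[of r i] nd lf by auto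
        next
          case False
          then show ?thesis using nd signed_partner(2)[of i] lf by auto
        qed
        then show ?thesis using e uz r i pi nd by simp
      qed
      moreover have "M $$ (r, w i) = - M $$ (r, w (partner i))" if cr: "crossing r i"
      proof -
        have "\<not> dominates r (partner i)" using cr by (simp add: crossing_def dominates_def)
        moreover have "mate_sign i = 1" using cr vertex_disjoint(4)[of i] by (simp add: crossing_def mate_sign_def)
        ultimately show ?thesis using e e' uz r pi by simp
      qed
      ultimately show ?thesis using lf unfolding generic_entry[OF r i] by simp
    qed
  qed (use Mc in \<open>simp_all add: generic_matrix_def\<close>)
  then show ?thesis unfolding M_def S_clan_def by blast
qed

section \<open>Normal forms of the points of the slice\<close>

lemma x_pivot_block_entry:
  assumes r: "r < n" and i: "i < n"
  shows "(x * pivot_block g) $$ (r, w i) =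
    (if r \<in> L then g $$ (r, w i)
     else if r \<in> R then (if i \<in> P \<union> L then - 1 else 1) * g $$ (partner r, w i)
     else if (r \<in> P) = (i \<in> P \<union> L) then g $$ (r, w i) else 0)"
proof -
  note e = x_mult_entry[OF pivot_block_carrier r w_less[OF i], of g]
    pivot_block_entry[OF r i, of g] pivot_block_entry[OF partner_less[OF r] i, of g]
  show ?thesis
    using r
  proof (cases rule: vertex_cases)
    case left
    then show ?thesis unfolding e by (simp add: mate_sign_def pivot_row_def)
  next
    case right
    then show ?thesis unfolding e by (simp add: mate_sign_def pivot_row_def)
  qed (simp_all add: e mate_sign_def pivot_row_def)
qed

text \<open>
  This is \<open>h = x D x\<inverse>\<close> for the pivot block \<open>D\<close> of \<open>u x\<close>. As \<open>D\<close> is block diagonal, \<open>h\<close> fixes the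
  coset \<open>x K\<close> when it is invertible, so that \<open>u x K = u h\<inverse> x K\<close>.
\<close>

definition stabilizer_part :: "complex mat \<Rightarrow> complex mat" where
  "stabilizer_part u = divide_x (x * pivot_block (u * x))"

lemma stabilizer_part_entry:
  assumes u: "u \<in> carrier_mat n n" and r: "r < n" and i: "i < n"
  shows "stabilizer_part u $$ (r, i) =
    (if r \<in> L then u $$ (r, i)
     else if r \<in> R then (if i \<in> P then - 1 else 1) * u $$ (partner r, partner i)
     else if i \<in> P \<or> i \<in> N then (if (r \<in> P) = (i \<in> P) then u $$ (r, i) else 0)
     else (u $$ (r, i) - signum r * u $$ (r, partner i)) / 2)"
proof -
  note pi = partner_less[OF i]
  have ux: "(u * x) $$ (k, w i) = u $$ (k, i) + mate_sign i * u $$ (k, partner i)"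
    "(u * x) $$ (k, w (partner i)) = u $$ (k, partner i) - mate_sign i * u $$ (k, i)" if "k < n" for k
    using mult_x_entry[OF u that i] mult_x_entry[OF u that pi] by simp_all
  note e = stabilizer_part_def divide_x_entry[OF r i] x_pivot_block_entry[OF r i]
    x_pivot_block_entry[OF r pi] ux[OF r] ux[OF partner_less[OF r]]
  have r4: "r \<in> P \<and> r \<notin> N \<and> r \<notin> L \<and> r \<notin> R \<or> r \<in> N \<and> r \<notin> P \<and> r \<notin> L \<and> r \<notin> R
      \<or> r \<in> L \<and> r \<notin> P \<and> r \<notin> N \<and> r \<notin> R \<or> r \<in> R \<and> r \<notin> P \<and> r \<notin> N \<and> r \<notin> L"
    using r by (cases rule: vertex_cases) simp_all
  show ?thesis
    using i
  proof (cases rule: vertex_cases)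
    case plus
    then show ?thesis using r4 unfolding e by (elim disjE) (simp_all add: mate_sign_def)
  next
    case minus
    then show ?thesis using r4 unfolding e by (elim disjE) (simp_all add: mate_sign_def)
  next
    case left
    then show ?thesis using r4 unfolding e
      by (elim disjE) (simp_all add: mate_sign_def signum_def)
  next
    case right
    then show ?thesis using r4 unfolding e
      by (elim disjE) (simp_all add: mate_sign_def signum_def)
  qed
qed

text \<open>
  Every entry of \<open>h\<close> at \<open>(r, i)\<close> is a combination of entries of \<open>u\<close> at \<open>(r, i)\<close>, at
  \<open>(partner r, partner i)\<close> or, for unmatched \<open>r\<close>, at \<open>(r, partner i)\<close>. Either all of these positions
  are admissible or none of them is.
\<close>

lemma stabilizer_part_U_clan:
  assumes "u \<in> U_clan"
  shows "stabilizer_part u \<in> U_clan"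
proof -
  have uc: "u \<in> carrier_mat n n" using assms by (rule U_clan_carrier)
  have uz: "u $$ (r, c) = 0" if "\<not> dominates r c" "r < n" "c < n" for r c
    using assms that unfolding U_clan_def by blast
  have ud: "u $$ (i, i) = 1" if "i < n" for i using assms that unfolding U_clan_def by blast
  have "stabilizer_part u $$ (i, i) = 1" if i: "i < n" for i
    unfolding stabilizer_part_entry[OF uc i i] using i
    by (cases rule: vertex_cases) (simp_all add: ud i partner_less[OF i])
  moreover have "stabilizer_part u $$ (r, i) = 0" if r: "r < n" and i: "i < n" and nd: "\<not> dominates r i" for r i
  proof -
    note p = partner_less[OF r] partner_less[OF i]
    have z: "u $$ (r, i) = 0" "u $$ (partner r, partner i) = 0"
      using uz nd r i p dominates_partner_iff by blast+
    have "u $$ (r, partner i) = 0" if "r \<notin> L" "r \<notin> R"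
    proof -
      have "partner r = r" using that by (simp add: partner_def)
      then show ?thesis using uz[OF _ r p(2)] nd dominates_partner_iff[of r i] by simp
    qed
    then show ?thesis unfolding stabilizer_part_entry[OF uc r i] using z by simp
  qed
  ultimately show ?thesis
    unfolding U_clan_def stabilizer_part_def by auto
qed

definition normal_form :: "complex mat \<Rightarrow> complex mat" where
  "normal_form g = g * inv\<^bsub>GL n\<^esub> (pivot_block g)"

lemma pivot_block_K: "pivot_block g \<in> carrier (GL n) \<Longrightarrow> pivot_block g \<in> K_grp p q"
  by (simp add: K_grp_iff off_block_zero_pivot_block)

text \<open>\<open>g k (D k)\<inverse> = g D\<inverse>\<close>.\<close>

lemma normal_form_mult_K:
  assumes g: "g \<in> carrier_mat n n" and b: "pivot_block g \<in> carrier (GL n)" and k: "k \<in> K_grp p q"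
  shows "pivot_block (g * k) \<in> carrier (GL n)" "normal_form (g * k) = normal_form g"
proof -
  have kG: "k \<in> carrier (GL n)" and kc: "k \<in> carrier_mat n n"
    using k by (simp_all add: K_grp_iff carrier_GL_iff)
  note bi = GL_inv[OF b] and ki = GL_inv[OF kG]
  have e: "pivot_block (g * k) = pivot_block g * k" by (rule pivot_block_mult_K[OF g k])
  show "pivot_block (g * k) \<in> carrier (GL n)" unfolding e by (rule GL_mult[OF b kG])
  have "inv\<^bsub>GL n\<^esub> (pivot_block g * k) = inv\<^bsub>GL n\<^esub> k * inv\<^bsub>GL n\<^esub> (pivot_block g)"
    using group.inv_mult_group[OF group_GL b kG] by simp
  then have "normal_form (g * k) = g * k * (inv\<^bsub>GL n\<^esub> k * inv\<^bsub>GL n\<^esub> (pivot_block g))"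
    by (simp add: normal_form_def e)
  also have "\<dots> = g * (k * inv\<^bsub>GL n\<^esub> k * inv\<^bsub>GL n\<^esub> (pivot_block g))"
    using g kc bi(2) ki(2) by (simp add: square_simps)
  also have "\<dots> = normal_form g"
    unfolding ki(3) normal_form_def by (simp add: left_mult_one_mat[OF bi(2)])
  finally show "normal_form (g * k) = normal_form g" .
qed

lemma normal_form_carrier:
  assumes "g \<in> carrier_mat n n" "pivot_block g \<in> carrier (GL n)"
  shows "normal_form g \<in> carrier_mat n n"
  unfolding normal_form_def by (rule mult_carrier_mat[OF assms(1) GL_inv(2)[OF assms(2)]])

lemma normal_form_in_coset:
  assumes "g \<in> carrier_mat n n" "pivot_block g \<in> carrier (GL n)"
  shows "normal_form g \<in> coset p q g"
  unfolding normal_form_def coset_eq using K_grp_inv[OF pivot_block_K[OF assms(2)]] by blast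

lemma one_GL: "1\<^sub>m n \<in> carrier (GL n)"
  using K_grp_one K_grp_iff by blast

lemma normal_form_S_clan:
  assumes "M \<in> S_clan p q \<alpha>"
  shows "normal_form M = M"
proof -
  have "inv\<^bsub>GL n\<^esub> (1\<^sub>m n) = 1\<^sub>m n" using GL_inv(2,3)[OF one_GL] by (metis left_mult_one_mat)
  then show ?thesis
    using S_clan_factorization(3,4)[OF assms] by (simp add: normal_form_def right_mult_one_mat)
qed

text \<open>
  From \<open>h x = x D\<close> the pivot block \<open>D\<close> of \<open>u x\<close> inherits its invertibility from \<open>h\<close>, and
  \<open>u x D\<inverse> = (u h\<inverse>) x\<close> is in \<open>U x\<close> with pivot block \<open>D D\<inverse> = 1\<close>.
\<close>

lemma normal_form_slice:
  assumes u: "u \<in> U_clan"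
  shows "pivot_block (u * x) \<in> carrier (GL n)" "normal_form (u * x) \<in> S_clan p q \<alpha>"
proof -
  let ?B = "pivot_block (u * x)" and ?h = "stabilizer_part u"
  have uc: "u \<in> carrier_mat n n" using u by (rule U_clan_carrier)
  have g: "u * x \<in> carrier_mat n n" by (rule mult_carrier_mat[OF uc x_carrier])
  have hU: "?h \<in> U_clan" using u by (rule stabilizer_part_U_clan)
  have hc: "?h \<in> carrier_mat n n" using hU by (rule U_clan_carrier)
  have hx: "?h * x = x * ?B"
    unfolding stabilizer_part_def by (rule divide_x_mult_x) (rule mult_carrier_mat[OF x_carrier pivot_block_carrier])
  have "det ?h * det x = det x * det ?B"
    using arg_cong[OF hx, of det] by (simp add: det_mult[OF hc x_carrier] det_mult[OF x_carrier pivot_block_carrier])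
  then show B: "?B \<in> carrier (GL n)"
    using x_GL U_clan_GL[OF hU] by (auto simp: carrier_GL_iff)
  note hi = GL_inv[OF U_clan_GL[OF hU]] and bi = GL_inv[OF B]
  have "inv\<^bsub>GL n\<^esub> ?h * x = inv\<^bsub>GL n\<^esub> ?h * (x * ?B) * inv\<^bsub>GL n\<^esub> ?B"
    using hi(2) bi(2,3) by (simp add: square_simps right_mult_one_mat[of _ n n])
  also have "\<dots> = inv\<^bsub>GL n\<^esub> ?h * ?h * (x * inv\<^bsub>GL n\<^esub> ?B)"
    unfolding hx[symmetric] using hi(2) hc bi(2) by (simp add: square_simps)
  also have "\<dots> = x * inv\<^bsub>GL n\<^esub> ?B"
    unfolding hi(4) by (rule left_mult_one_mat[OF mult_carrier_mat[OF x_carrier bi(2)]])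
  finally have hx': "inv\<^bsub>GL n\<^esub> ?h * x = x * inv\<^bsub>GL n\<^esub> ?B" .
  have nf: "normal_form (u * x) = u * inv\<^bsub>GL n\<^esub> ?h * x"
    unfolding normal_form_def mult_assoc_square[OF uc x_carrier bi(2)] hx'[symmetric]
    by (rule mult_assoc_square[OF uc hi(2) x_carrier, symmetric])
  have "pivot_block (normal_form (u * x)) = ?B * inv\<^bsub>GL n\<^esub> ?B"
    unfolding normal_form_def by (rule pivot_block_mult_K[OF g K_grp_inv[OF pivot_block_K[OF B]]])
  then have "pivot_block (normal_form (u * x)) = 1\<^sub>m n" unfolding bi(3) .
  then show "normal_form (u * x) \<in> S_clan p q \<alpha>"
    using S_clanI[OF U_clan_divide[OF u hU]] unfolding nf by blast
qed

section \<open>The isomorphism\<close>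

lemma inverse_entry:
  assumes "D \<in> carrier (GL n)" "i < n" "j < n"
  shows "(inv\<^bsub>GL n\<^esub> D) $$ (i, j) = adj_mat D $$ (i, j) / det D"
proof -
  have D: "D \<in> carrier_mat n n" "det D \<noteq> 0" using assms(1) by (simp_all add: carrier_GL_iff)
  note adj = adj_mat[OF D(1)]
  have "(1 / det D) \<cdot>\<^sub>m adj_mat D * D = 1\<^sub>m n"
    using D adj by (simp add: mult_smult_assoc_mat[OF adj(1) D(1)]) (auto intro!: eq_matI)
  then have "inv\<^bsub>GL n\<^esub> D = (1 / det D) \<cdot>\<^sub>m adj_mat D"
    using adj(1) D(1) by (intro GL_of_left_inverse(3)) auto
  then show ?thesis using adj(1) assms(2,3) by simp
qed

lemma poly_pivot_block_entry:
  assumes "a < n" "b < n"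
  shows "poly_fun n (\<lambda>g. if (a < p) = (b < p) then g $$ (pivot p \<alpha> a, b) else 0)"
proof (cases "(a < p) = (b < p)")
  case True
  then show ?thesis using poly_fun.entry[OF pivot_less[OF assms(1)] assms(2)] by (simp only: if_True HOL.refl)
next
  case False
  then show ?thesis using poly_fun.const[of n 0] by (simp only: if_False)
qed

text \<open>
  By Cramer's rule the only denominator is the determinant of the pivot block; the factor \<open>det_fun\<close> is
  put in the numerator as well to match the equation of the domain.
\<close>

lemma rational_normal_form:
  assumes ij: "i < n" "j < n"
  shows "rational_over n (\<lambda>g. det_fun n g * det (pivot_block g)) (\<lambda>g. normal_form g $$ (i, j))"
  unfolding rational_over_def
proof (intro exI conjI ballI)
  let ?a = "\<lambda>g. det_fun n g * (\<Sum>k<n. g $$ (i, k) * adj_mat (pivot_block g) $$ (k, j))"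
  show "poly_fun n ?a"
    unfolding pivot_block_def
    by (intro poly_fun.mult poly_det_fun poly_fun_sum poly_fun.entry poly_fun_adj_mat poly_pivot_block_entry) (use ij in auto)
  fix g assume "g \<in> principal_open n (\<lambda>g. det_fun n g * det (pivot_block g))"
  then have g: "g \<in> carrier_mat n n" "det_fun n g \<noteq> 0" "pivot_block g \<in> carrier (GL n)"
    by (auto simp: principal_open_def carrier_GL_iff)
  have "normal_form g $$ (i, j) = (\<Sum>k<n. g $$ (i, k) * (inv\<^bsub>GL n\<^esub> (pivot_block g)) $$ (k, j))"
    unfolding normal_form_def by (rule mult_entry[OF g(1) GL_inv(2)[OF g(3)] ij])
  also have "\<dots> = (\<Sum>k<n. g $$ (i, k) * (adj_mat (pivot_block g) $$ (k, j) / det (pivot_block g)))"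
    by (intro sum.cong refl) (simp add: inverse_entry[OF g(3) _ ij(2)])
  also have "\<dots> = (\<Sum>k<n. g $$ (i, k) * adj_mat (pivot_block g) $$ (k, j)) / det (pivot_block g)"
    by (simp add: sum_divide_distrib)
  also have "\<dots> = ?a g / (det_fun n g * det (pivot_block g)) ^ 1"
    using g(2) by simp
  finally show "normal_form g $$ (i, j) = ?a g / (det_fun n g * det (pivot_block g)) ^ 1" .
qed

lemma poly_det_pivot_block: "poly_fun n (\<lambda>g. det (pivot_block g))"
  unfolding pivot_block_def
  by (intro poly_fun_det poly_pivot_block_entry)

lemma slice_eq: "slice p q \<alpha> = {coset p q (u * x) | u. u \<in> U_clan}"
  unfolding slice_def U_minus_Int_psi_eq ..

lemma slice_isomorphic: "fs_isomorphic (slice_variety p q \<alpha>) (S_variety p q \<alpha>)"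
  unfolding slice_variety_def S_variety_def
proof (rule isomorphic_by_canonical_form[where F = normal_form and d = "\<lambda>g. det (pivot_block g)"])
  let ?W = "principal_open n (\<lambda>g. det_fun n g * det (pivot_block g))"
  have W: "g \<in> ?W \<longleftrightarrow> g \<in> carrier (GL n) \<and> pivot_block g \<in> carrier (GL n)" for g
    by (auto simp: principal_open_def carrier_GL_iff det_fun_eq)
  have ux_GL: "u * x \<in> carrier (GL n)" if "u \<in> U_clan" for u
    using GL_mult[OF U_clan_GL[OF that] x_GL] .
  show "poly_fun n (\<lambda>g. det (pivot_block g))" by (rule poly_det_pivot_block)
  show "normal_form g \<in> carrier_mat n n" if "g \<in> ?W" for g
    using that normal_form_carrier unfolding W carrier_GL_iff by blast
  show "rational_over n (\<lambda>g. det_fun n g * det (pivot_block g)) (\<lambda>g. normal_form g $$ (i, j))"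
    if "i < n" "j < n" for i j
    using that by (rule rational_normal_form)
  show "g * k \<in> ?W \<and> normal_form (g * k) = normal_form g" if "g \<in> ?W" "k \<in> K_grp p q" for g k
    using that normal_form_mult_K[of g k] GL_mult[of g n k] unfolding W K_grp_iff
    by (simp add: carrier_GL_iff)
  show "S_clan p q \<alpha> \<subseteq> ?W"
  proof
    fix M assume M: "M \<in> S_clan p q \<alpha>"
    show "M \<in> ?W"
      unfolding W using S_clan_factorization[OF M] ux_GL[of "divide_x M"] one_GL by simp
  qed
  show "normal_form M = M" if "M \<in> S_clan p q \<alpha>" for M
    using that by (rule normal_form_S_clan)
  show "\<exists>g\<in>?W. C = coset p q g \<and> normal_form g \<in> S_clan p q \<alpha> \<and> normal_form g \<in> coset p q g"
    if "C \<in> slice p q \<alpha>" for C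
  proof -
    obtain u where u: "u \<in> U_clan" "C = coset p q (u * x)" using \<open>C \<in> slice p q \<alpha>\<close> slice_eq by auto
    have "u * x \<in> carrier_mat n n" using ux_GL[OF u(1)] by (simp add: carrier_GL_iff)
    then show ?thesis
      using u normal_form_slice[OF u(1)] ux_GL normal_form_in_coset
      by (intro bexI[of _ "u * x"]) (simp_all add: W)
  qed
  show "coset p q M \<in> slice p q \<alpha>" if "M \<in> S_clan p q \<alpha>" for M
    using S_clan_factorization(1,2)[OF that] unfolding slice_eq by force
qed

end

theorem theorem3p6:
  fixes p q :: nat and \<alpha> :: clan
  assumes "\<alpha> \<in> clans p q"
  shows "fs_isomorphic (slice_variety p q \<alpha>) (S_variety p q \<alpha>)"
  using clan_setup.slice_isomorphic[OF clan_setup.intro[OF assms]] .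

end
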